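(* Let $k$ be a field of characteristic $0$ and let $\varphi\in k\langle\langle X_0,X_1\rangle\rangle$ be a group-like non-commutative formal power series. Suppose that $\varphi$ satisfies Drinfel'd's pentagon equation $$\varphi(t_{12},t_{23}+t_{24})\,\varphi(t_{13}+t_{23},t_{34})=\varphi(t_{23},t_{34})\,\varphi(t_{12}+t_{13},t_{24}+t_{34})\,\varphi(t_{12},t_{23})$$ in the completed universal enveloping algebra of $\mathfrak a_4$. Then $\varphi$ also satisfies the generalized double shuffle relation $$\Delta_*(\varphi_* )=\varphi_*\,\widehat\otimes\,\varphi_* .$$
   Context: $k\langle\langle X_0,X_1\rangle\rangle$ is the ring of non-commutative formal power series in $X_0,X_1$ over $k$. A series $\varphi$ is group-like if its constant term is $1$ and $\Delta(\varphi)=\varphi\widehat\otimes\varphi$, where $\Delta$ is the (continuous algebra) coproduct with $\Delta(X_i)=X_i\otimes1+1\otimes X_i$ ($i=0,1$) and $\widehat\otimes$ is the completed tensor product. For a (continuous) algebra homomorphism $\iota$ from $k\langle\langle X_0,X_1\rangle\rangle$ the image $\iota(\varphi)$ is denoted $\varphi(\iota(X_0),\iota(X_1))$. For a word $W$ in $X_0,X_1$, $c_W(\varphi)$ denotes the coefficient of $W$ in $\varphi$. $\mathfrak a_4$ is the completion (with respect to the natural grading) of the pure braid Lie algebra with 4 strings: the Lie algebra over $k$ with generators $t_{ij}$ ($1\le i,j\le4$) and relations $t_{ii}=0$, $t_{ij}=t_{ji}$, $[t_{ij},t_{ik}+t_{jk}]=0$ ($i,j,k$ all distinct), $[t_{ij},t_{kl}]=0$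 ($i,j,k,l$ all distinct). Let $\pi_Y:k\langle\langle X_0,X_1\rangle\rangle\to k\langle\langle Y_1,Y_2,\dots\rangle\rangle$ be the (continuous) $k$-linear map sending all words ending in $X_0$ to $0$ and sending the word $X_0^{n_m-1}X_1\cdots X_0^{n_1-1}X_1$ ($n_1,\dots,n_m\ge1$) to $(-1)^mY_{n_m}\cdots Y_{n_1}$ (and $1\mapsto 1$). Let $\Delta_*$ be the coproduct (continuous algebra homomorphism) on $k\langle\langle Y_1,Y_2,\dots\rangle\rangle$ with $\Delta_*(Y_n)=\sum_{i=0}^nY_i\otimes Y_{n-i}$, $Y_0:=1$. The series shuffle regularization of $\varphi$ is $\varphi_*=\varphi_{\mathrm{corr}}\cdot\pi_Y(\varphi)$ with $$\varphi_{\mathrm{corr}}=\exp\Bigl(\sum_{n=1}^\infty\frac{(-1)^n}{n}c_{X_0^{n-1}X_1}(\varphi)\,Y_1^n\Bigr).$$ *)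

theory Defs
  imports "HOL-Library.Poly_Mapping" "HOL-Library.Product_Plus"
begin

section \<open>Formal power series over a monoid\<close>

text \<open>
  Words form the free monoid under concatenation, written additively so that
  \<open>'a list \<Rightarrow>\<^sub>0 'k\<close> with its library ring structure is the free associative
  \<open>'k\<close>-algebra on \<open>'a\<close>.
\<close>

instantiation list :: (type) monoid_add
begin

definition zero_list :: "'a list" where "0 = []"

definition plus_list :: "'a list \<Rightarrow> 'a list \<Rightarrow> 'a list" where "u + v = u @ v"

instance
  by standard (simp_all add: zero_list_def plus_list_def)

end

class finite_split_monoid = monoid_add +
  assumes finite_splits: "finite {(u, v). u + v = w}"

instance list :: (type) finite_split_monoid
proof
  fix w :: "'a list"
  have "{(u, v). u + v = w} \<subseteq> (\<lambda>i. (take i w, drop i w)) ` {..length w}"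
  proof
    fix p assume "p \<in> {(u, v). u + v = w}"
    then have "p = (take (length (fst p)) w, drop (length (fst p)) w)" "length (fst p) \<le> length w"
      by (auto simp: plus_list_def)
    then show "p \<in> (\<lambda>i. (take i w, drop i w)) ` {..length w}"
      by blast
  qed
  then show "finite {(u, v). u + v = w}"
    by (rule finite_subset) simp
qed

instance prod :: (finite_split_monoid, finite_split_monoid) finite_split_monoid
proof
  fix w :: "'a \<times> 'b"
  have "{(u, v). u + v = w} \<subseteq>
      (\<lambda>((a, b), (c, d)). ((a, c), (b, d))) `
        ({(u, v). u + v = fst w} \<times> {(u, v). u + v = snd w})"
    by (force simp: image_iff)
  then show "finite {(u, v). u + v = w}"
    by (rule finite_subset) (simp add: finite_splits)
qed

text \<open>
  \<open>('a list, 'k) mseries\<close> is \<open>k\<langle>\<langle>a\<rangle>\<rangle>\<close>, and \<open>('a list \<times> 'b list, 'k) mseries\<close> is the completed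
  tensor product of \<open>k\<langle>\<langle>a\<rangle>\<rangle>\<close> and \<open>k\<langle>\<langle>b\<rangle>\<rangle>\<close>, the pair \<open>(u, v)\<close> standing for \<open>u \<otimes> v\<close>.
\<close>

typedef ('m, 'k) mseries = "UNIV :: ('m \<Rightarrow> 'k) set"
  morphisms mcoeff Mseries ..

setup_lifting type_definition_mseries

lemma mseries_eqI: "(\<And>w. mcoeff f w = mcoeff g w) \<Longrightarrow> f = g"
  by (simp add: mcoeff_inject[symmetric] fun_eq_iff)

lemma mcoeff_Mseries [simp]: "mcoeff (Mseries f) = f"
  by (simp add: Mseries_inverse)

instantiation mseries :: (type, ab_group_add) ab_group_add
begin

lift_definition zero_mseries :: "('a, 'b) mseries" is "\<lambda>_. 0" .
lift_definition plus_mseries :: "('a, 'b) mseries \<Rightarrow> ('a, 'b) mseries \<Rightarrow> ('a, 'b) mseries"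
  is "\<lambda>f g w. f w + g w" .
lift_definition uminus_mseries :: "('a, 'b) mseries \<Rightarrow> ('a, 'b) mseries"
  is "\<lambda>f w. - f w" .
lift_definition minus_mseries :: "('a, 'b) mseries \<Rightarrow> ('a, 'b) mseries \<Rightarrow> ('a, 'b) mseries"
  is "\<lambda>f g w. f w - g w" .

instance
  by standard (transfer; simp add: fun_eq_iff algebra_simps)+

end

lemmas mcoeff_group_simps [simp] =
  zero_mseries.rep_eq plus_mseries.rep_eq uminus_mseries.rep_eq minus_mseries.rep_eq

instantiation mseries :: (finite_split_monoid, ring_1) ring_1
begin

lift_definition one_mseries :: "('a, 'b) mseries" is "\<lambda>w. if w = 0 then 1 else 0" .
lift_definition times_mseries :: "('a, 'b) mseries \<Rightarrow> ('a, 'b) mseries \<Rightarrow> ('a, 'b) mseries"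
  is "\<lambda>f g w. \<Sum>(u, v) \<in> {(u, v). u + v = w}. f u * g v" .

instance
proof
  fix f g h :: "('a, 'b) mseries"
  show "f * g * h = f * (g * h)"
  proof (rule mseries_eqI)
    fix w
    let ?S = "\<lambda>w :: 'a. {(u, v). u + v = w}"
    have "mcoeff (f * g * h) w =
        (\<Sum>p\<in>?S w. \<Sum>q\<in>?S (fst p). mcoeff f (fst q) * mcoeff g (snd q) * mcoeff h (snd p))"
      by (simp add: times_mseries.rep_eq case_prod_unfold sum_distrib_right)
    also have "\<dots> = (\<Sum>(p, q)\<in>(SIGMA p:?S w. ?S (fst p)).
        mcoeff f (fst q) * mcoeff g (snd q) * mcoeff h (snd p))"
      by (rule sum.Sigma) (auto simp: finite_splits)
    also have "\<dots> = (\<Sum>(p, q)\<in>(SIGMA p:?S w. ?S (snd p)).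
        mcoeff f (fst p) * (mcoeff g (fst q) * mcoeff h (snd q)))"
      by (rule sum.reindex_bij_witness[where
            i = "\<lambda>((a, _), (b, c)). ((a + b, c), (a, b))" and
            j = "\<lambda>((_, c), (a, b)). ((a, b + c), (b, c))"])
        (auto simp: add.assoc mult.assoc)
    also have "\<dots> = (\<Sum>p\<in>?S w. \<Sum>q\<in>?S (snd p).
        mcoeff f (fst p) * (mcoeff g (fst q) * mcoeff h (snd q)))"
      by (rule sum.Sigma[symmetric]) (auto simp: finite_splits)
    also have "\<dots> = mcoeff (f * (g * h)) w"
      by (simp add: times_mseries.rep_eq case_prod_unfold sum_distrib_left)
    finally show "mcoeff (f * g * h) w = mcoeff (f * (g * h)) w" .
  qed
  show "1 * f = f"
  proof (rule mseries_eqI)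
    fix w
    have "mcoeff (1 * f) w = (\<Sum>(u, v)\<in>{(0, w)}. mcoeff 1 u * mcoeff f v)"
      unfolding times_mseries.rep_eq
      by (rule sum.mono_neutral_right) (auto simp: finite_splits one_mseries.rep_eq split: if_splits)
    then show "mcoeff (1 * f) w = mcoeff f w"
      by (simp add: one_mseries.rep_eq)
  qed
  show "f * 1 = f"
  proof (rule mseries_eqI)
    fix w
    have "mcoeff (f * 1) w = (\<Sum>(u, v)\<in>{(w, 0)}. mcoeff f u * mcoeff 1 v)"
      unfolding times_mseries.rep_eq
      by (rule sum.mono_neutral_right) (auto simp: finite_splits one_mseries.rep_eq split: if_splits)
    then show "mcoeff (f * 1) w = mcoeff f w"
      by (simp add: one_mseries.rep_eq)
  qed
  show "(f + g) * h = f * h + g * h" "f * (g + h) = f * g + f * h"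
    by (rule mseries_eqI;
        simp add: times_mseries.rep_eq case_prod_unfold algebra_simps sum.distrib)+
  have "mcoeff (0 :: ('a, 'b) mseries) 0 \<noteq> mcoeff 1 0"
    by (simp add: one_mseries.rep_eq)
  then show "(0 :: ('a, 'b) mseries) \<noteq> 1"
    by metis
qed

end

definition mscale :: "'k \<Rightarrow> ('m, 'k) mseries \<Rightarrow> ('m, 'k :: ring_1) mseries" where
  "mscale c f = Mseries (\<lambda>w. c * mcoeff f w)"

definition mletter :: "'a \<Rightarrow> ('a list, 'k :: ring_1) mseries" where
  "mletter a = Mseries (\<lambda>w. if w = [a] then 1 else 0)"

text \<open>
  The infinite sum of a family of series. It is only meaningful if every word has a nonzero
  coefficient in finitely many members of the family, as \<open>Sum_any\<close> is \<open>0\<close> otherwise.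
\<close>

definition msum :: "('i \<Rightarrow> ('m, 'k) mseries) \<Rightarrow> ('m, 'k :: ring_1) mseries" where
  "msum F = Mseries (\<lambda>w. Sum_any (\<lambda>i. mcoeff (F i) w))"

text \<open>The argument of \<open>mexp\<close> is meant to have constant term 0.\<close>

definition mexp :: "('m :: finite_split_monoid, 'k :: field_char_0) mseries \<Rightarrow> ('m, 'k) mseries" where
  "mexp f = msum (\<lambda>j. mscale (1 / fact j) (f ^ j))"

text \<open>The continuous algebra homomorphism with \<open>a \<mapsto> \<delta> a\<close> on letters.\<close>

definition continuous_hom ::
    "('a \<Rightarrow> ('m :: finite_split_monoid, 'k :: ring_1) mseries) \<Rightarrow> ('a list, 'k) mseries \<Rightarrow> ('m, 'k) mseries"
where
  "continuous_hom \<delta> f = msum (\<lambda>w. mscale (mcoeff f w) (prod_list (map \<delta> w)))"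

text \<open>Well-definedness of \<^const>\<open>continuous_hom\<close> when letters have homogeneous images of positive degree.\<close>

lemma mcoeff_prod_list_weight:
  fixes \<omega> :: "'m :: finite_split_monoid \<Rightarrow> nat" and \<delta> :: "'a \<Rightarrow> ('m, 'k :: ring_1) mseries"
  assumes add: "\<omega> 0 = 0" "\<And>u v. \<omega> (u + v) = \<omega> u + \<omega> v"
    and hom: "\<And>a m. mcoeff (\<delta> a) m \<noteq> 0 \<Longrightarrow> \<omega> m = wt a"
    and "mcoeff (prod_list (map \<delta> w)) m \<noteq> 0"
  shows "\<omega> m = sum_list (map wt w)"
  using assms(4)
proof (induction w arbitrary: m)
  case Nil
  then show ?case by (auto simp: one_mseries.rep_eq add split: if_splits)
next
  case (Cons a w)
  then obtain u v where uv: "u + v = m" "mcoeff (\<delta> a) u * mcoeff (prod_list (map \<delta> w)) v \<noteq> 0"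
    by (force simp: times_mseries.rep_eq elim: sum.not_neutral_contains_not_neutral)
  then have "mcoeff (\<delta> a) u \<noteq> 0" "mcoeff (prod_list (map \<delta> w)) v \<noteq> 0"
    by auto
  with hom Cons.IH uv(1) add show ?case by fastforce
qed

lemma continuous_hom_locally_finite:
  fixes \<omega> :: "'m :: finite_split_monoid \<Rightarrow> nat" and \<delta> :: "'a \<Rightarrow> ('m, 'k :: ring_1) mseries"
  assumes "\<omega> 0 = 0" "\<And>u v. \<omega> (u + v) = \<omega> u + \<omega> v"
    and "\<And>a m. mcoeff (\<delta> a) m \<noteq> 0 \<Longrightarrow> \<omega> m = wt a"
    and pos: "\<And>a. wt a > 0" and fin: "\<And>n. finite {a. wt a \<le> n}"
  shows "finite {w. mcoeff (prod_list (map \<delta> w)) m \<noteq> 0}"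
proof (rule finite_subset)
  show "{w. mcoeff (prod_list (map \<delta> w)) m \<noteq> 0}
      \<subseteq> {w. set w \<subseteq> {a. wt a \<le> \<omega> m} \<and> length w \<le> \<omega> m}"
  proof clarify
    fix w assume "mcoeff (prod_list (map \<delta> w)) m \<noteq> 0"
    with mcoeff_prod_list_weight[of \<omega> \<delta> wt] assms have w: "\<omega> m = sum_list (map wt w)"
      by blast
    have "length w \<le> sum_list (map wt w)"
      using add_mono[OF Suc_leI[OF pos]] by (induction w) simp_all
    with w member_le_sum_list[of _ "map wt w"] show "set w \<subseteq> {a. wt a \<le> \<omega> m} \<and> length w \<le> \<omega> m"
      by auto
  qed
  show "finite {w. set w \<subseteq> {a. wt a \<le> \<omega> m} \<and> length w \<le> \<omega> m}"
    using finite_lists_length_le[OF fin] .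
qed

definition mtensor ::
    "('a list, 'k) mseries \<Rightarrow> ('b list, 'k) mseries \<Rightarrow> ('a list \<times> 'b list, 'k :: ring_1) mseries"
  (infixr \<open>\<otimes>\<^sub>m\<close> 75) where
  "f \<otimes>\<^sub>m g = Mseries (\<lambda>(u, v). mcoeff f u * mcoeff g v)"


section \<open>Group-like series in two variables\<close>

datatype xletter = X0 | X1

definition coprod_X ::
    "(xletter list, 'k :: field_char_0) mseries \<Rightarrow> (xletter list \<times> xletter list, 'k) mseries" where
  "coprod_X = continuous_hom (\<lambda>a. mletter a \<otimes>\<^sub>m 1 + 1 \<otimes>\<^sub>m mletter a)"

lemma coprod_X_locally_finite:
  "finite {w. mcoeff (prod_list (map (\<lambda>a :: xletter.
     mletter a \<otimes>\<^sub>m 1 + 1 \<otimes>\<^sub>m mletter a :: (_, 'k :: field_char_0) mseries) w)) m \<noteq> 0}"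
proof (rule continuous_hom_locally_finite[where \<omega> = "\<lambda>(u, v). length u + length v" and wt = "\<lambda>_. 1"])
  have "finite (UNIV :: xletter set)"
    by (rule finite_subset[of _ "{X0, X1}"]) (auto intro: xletter.exhaust)
  then show "finite {a :: xletter. 1 \<le> n}" for n :: nat
    by (rule rev_finite_subset) auto
next
  fix a :: xletter and m
  assume m: "mcoeff (mletter a \<otimes>\<^sub>m 1 + 1 \<otimes>\<^sub>m mletter a :: (_, 'k) mseries) m \<noteq> 0"
  obtain u v where [simp]: "m = (u, v)" by force
  from m show "(case m of (u, v) \<Rightarrow> length u + length v) = 1"
    by (cases "u = []"; cases "v = []"; cases "u = [a]"; cases "v = [a]")
      (simp_all add: mtensor_def mletter_def one_mseries.rep_eq zero_list_def)
qed (simp_all add: zero_prod_def zero_list_def plus_list_def plus_prod_def split: prod.splits)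

definition group_like :: "(xletter list, 'k :: field_char_0) mseries \<Rightarrow> bool" where
  "group_like \<phi> \<longleftrightarrow> mcoeff \<phi> [] = 1 \<and> coprod_X \<phi> = \<phi> \<otimes>\<^sub>m \<phi>"


section \<open>Lie algebras by generators and relations, and their enveloping algebras\<close>

text \<open>
  The Lie algebra generated by \<open>'g\<close> subject to relations \<open>R\<close> is the free nonassociative algebra
  \<open>'g magma \<Rightarrow>\<^sub>0 'k\<close> modulo \<open>lie_ideal R\<close>.
\<close>

datatype 'g magma = Gen 'g | Mul "'g magma" "'g magma"

type_synonym ('g, 'k) nonassoc = "'g magma \<Rightarrow>\<^sub>0 'k"

definition gen :: "'g \<Rightarrow> ('g, 'k :: field_char_0) nonassoc" where
  "gen g = Poly_Mapping.single (Gen g) 1"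

definition nscale :: "'k \<Rightarrow> ('g, 'k) nonassoc \<Rightarrow> ('g, 'k :: field_char_0) nonassoc" where
  "nscale c x = Poly_Mapping.map ((*) c) x"

definition bracket :: "('g, 'k) nonassoc \<Rightarrow> ('g, 'k) nonassoc \<Rightarrow> ('g, 'k :: field_char_0) nonassoc" where
  "bracket x y = (\<Sum>s\<in>Poly_Mapping.keys x. \<Sum>t\<in>Poly_Mapping.keys y.
     Poly_Mapping.single (Mul s t) (Poly_Mapping.lookup x s * Poly_Mapping.lookup y t))"

inductive_set lie_ideal :: "('g, 'k :: field_char_0) nonassoc set \<Rightarrow> ('g, 'k) nonassoc set"
  for R where
  rel: "r \<in> R \<Longrightarrow> r \<in> lie_ideal R"
| alternating: "bracket x x \<in> lie_ideal R"
| jacobi: "bracket x (bracket y z) + bracket y (bracket z x) + bracket z (bracket x y) \<in> lie_ideal R"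
| zero: "0 \<in> lie_ideal R"
| add: "x \<in> lie_ideal R \<Longrightarrow> y \<in> lie_ideal R \<Longrightarrow> x + y \<in> lie_ideal R"
| scale: "x \<in> lie_ideal R \<Longrightarrow> nscale c x \<in> lie_ideal R"
| bracket_left: "x \<in> lie_ideal R \<Longrightarrow> bracket y x \<in> lie_ideal R"
| bracket_right: "x \<in> lie_ideal R \<Longrightarrow> bracket x y \<in> lie_ideal R"

text \<open>
  The universal enveloping algebra is the free associative algebra on the underlying set of the Lie
  algebra (presented by representatives) modulo \<open>env_ideal R\<close>, which makes \<open>env\<close> well defined on
  classes modulo \<open>lie_ideal R\<close>, linear, and compatible with brackets.
\<close>

type_synonym ('g, 'k) env_rep = "('g, 'k) nonassoc list \<Rightarrow>\<^sub>0 'k"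

definition env :: "('g, 'k) nonassoc \<Rightarrow> ('g, 'k :: field_char_0) env_rep" where
  "env x = Poly_Mapping.single [x] 1"

definition env_const :: "'k \<Rightarrow> ('g, 'k :: field_char_0) env_rep" where
  "env_const c = Poly_Mapping.single [] c"

inductive_set env_ideal :: "('g, 'k :: field_char_0) nonassoc set \<Rightarrow> ('g, 'k) env_rep set"
  for R where
  cong: "x - y \<in> lie_ideal R \<Longrightarrow> env x - env y \<in> env_ideal R"
| env_add: "env (x + y) - (env x + env y) \<in> env_ideal R"
| env_scale: "env (nscale c x) - env_const c * env x \<in> env_ideal R"
| env_bracket: "env (bracket x y) - (env x * env y - env y * env x) \<in> env_ideal R"
| zero: "0 \<in> env_ideal R"
| add: "p \<in> env_ideal R \<Longrightarrow> q \<in> env_ideal R \<Longrightarrow> p + q \<in> env_ideal R"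
| mult_left: "p \<in> env_ideal R \<Longrightarrow> q * p \<in> env_ideal R"
| mult_right: "p \<in> env_ideal R \<Longrightarrow> p * q \<in> env_ideal R"

text \<open>
  For homogeneous \<open>R\<close>, \<open>env_filtration R n\<close> is the preimage of the part of degree at least \<open>n\<close> of
  the enveloping algebra, graded by giving every generator degree 1.
\<close>

inductive_set env_filtration :: "('g, 'k :: field_char_0) nonassoc set \<Rightarrow> nat \<Rightarrow> ('g, 'k) env_rep set"
  for R n where
  ideal: "p \<in> env_ideal R \<Longrightarrow> p \<in> env_filtration R n"
| monomial: "n \<le> length gs \<Longrightarrow>
    env_const c * prod_list (map (\<lambda>g. env (gen g)) gs) \<in> env_filtration R n"
| add: "p \<in> env_filtration R n \<Longrightarrow> q \<in> env_filtration R n \<Longrightarrow> p + q \<in> env_filtration R n"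

text \<open>
  The degree completion is the inverse limit over \<open>n\<close> of the quotients by \<open>env_filtration R n\<close>.
  Its elements are represented by sequences whose \<open>n\<close>-th term gives the class at level \<open>n\<close>.
  Ring operations are termwise, and equality is congruence at every level.
\<close>

type_synonym ('g, 'k) env_completed = "nat \<Rightarrow> ('g, 'k) env_rep"

definition env_completed_times ::
    "('g, 'k) env_completed \<Rightarrow> ('g, 'k) env_completed \<Rightarrow> ('g, 'k :: field_char_0) env_completed"
  (infixl \<open>\<odot>\<close> 70) where
  "p \<odot> q = (\<lambda>n. p n * q n)"

definition env_completed_eq ::
    "('g, 'k :: field_char_0) nonassoc set \<Rightarrow> ('g, 'k) env_completed \<Rightarrow> ('g, 'k) env_completed \<Rightarrow> bool" where
  "env_completed_eq R p q \<longleftrightarrow> (\<forall>n. p n - q n \<in> env_filtration R n)"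

text \<open>
  \<open>subst \<phi> x y\<close> is \<open>\<phi>(x, y)\<close>, where \<open>x\<close> and \<open>y\<close> are linear combinations of generators. The words
  omitted at level \<open>n\<close> have image of degree at least \<open>n\<close>.
\<close>

definition subst ::
    "(xletter list, 'k) mseries \<Rightarrow> ('g, 'k) nonassoc \<Rightarrow> ('g, 'k) nonassoc
      \<Rightarrow> ('g, 'k :: field_char_0) env_completed" where
  "subst \<phi> x y = (\<lambda>n. \<Sum>W | length W < n. env_const (mcoeff \<phi> W) *
     prod_list (map (\<lambda>a. env (case a of X0 \<Rightarrow> x | X1 \<Rightarrow> y)) W))"


section \<open>The pentagon equation\<close>

datatype strand = S1 | S2 | S3 | S4

definition tgen :: "strand \<Rightarrow> strand \<Rightarrow> (strand \<times> strand, 'k :: field_char_0) nonassoc" where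
  "tgen i j = gen (i, j)"

inductive_set braid_relations :: "(strand \<times> strand, 'k :: field_char_0) nonassoc set" where
  "tgen i i \<in> braid_relations"
| "tgen i j - tgen j i \<in> braid_relations"
| "distinct [i, j, k] \<Longrightarrow> bracket (tgen i j) (tgen i k + tgen j k) \<in> braid_relations"
| "distinct [i, j, k, l] \<Longrightarrow> bracket (tgen i j) (tgen k l) \<in> braid_relations"

definition pentagon :: "(xletter list, 'k :: field_char_0) mseries \<Rightarrow> bool" where
  "pentagon \<phi> \<longleftrightarrow> env_completed_eq braid_relations
     (subst \<phi> (tgen S1 S2) (tgen S2 S3 + tgen S2 S4) \<odot> subst \<phi> (tgen S1 S3 + tgen S2 S3) (tgen S3 S4))
     (subst \<phi> (tgen S2 S3) (tgen S3 S4) \<odot> subst \<phi> (tgen S1 S2 + tgen S1 S3) (tgen S2 S4 + tgen S3 S4)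
       \<odot> subst \<phi> (tgen S1 S2) (tgen S2 S3))"


section \<open>The series shuffle regularization\<close>

text \<open>
  Series in \<open>Y\<^sub>1, Y\<^sub>2, \<dots>\<close> use the alphabet \<open>nat\<close>, where the letter \<open>n\<close> stands for \<open>Y\<^sub>n\<^sub>+\<^sub>1\<close>.
  The function \<open>Yser\<close> has the usual indexing, with \<open>Yser 0 = 1\<close>.
\<close>

fun Yser :: "nat \<Rightarrow> (nat list, 'k :: field_char_0) mseries" where
  "Yser 0 = 1"
| "Yser (Suc n) = mletter n"

definition coprod_star ::
    "(nat list, 'k :: field_char_0) mseries \<Rightarrow> (nat list \<times> nat list, 'k) mseries" where
  "coprod_star = continuous_hom (\<lambda>m. \<Sum>i\<le>Suc m. Yser i \<otimes>\<^sub>m Yser (Suc m - i))"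

lemma Y_weight: "mcoeff (Yser i :: (_, 'k :: field_char_0) mseries) u \<noteq> 0 \<Longrightarrow> sum_list (map Suc u) = i"
  by (cases i) (auto simp: mletter_def one_mseries.rep_eq zero_list_def split: if_splits)

lemma mcoeff_sum: "mcoeff (sum f A) w = (\<Sum>i\<in>A. mcoeff (f i) w)"
  by (induction A rule: infinite_finite_induct) auto

lemma coprod_star_locally_finite:
  "finite {w. mcoeff (prod_list (map (\<lambda>n. \<Sum>i\<le>Suc n.
     Yser i \<otimes>\<^sub>m Yser (Suc n - i) :: (_, 'k :: field_char_0) mseries) w)) m \<noteq> 0}"
proof (rule continuous_hom_locally_finite[where wt = Suc and
      \<omega> = "\<lambda>(u, v). sum_list (map Suc u) + sum_list (map Suc v)"])
  fix n m assume "mcoeff (\<Sum>i\<le>Suc n. Yser i \<otimes>\<^sub>m Yser (Suc n - i) :: (_, 'k) mseries) m \<noteq> 0"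
  then obtain i where i: "i \<le> Suc n" "mcoeff (Yser i \<otimes>\<^sub>m Yser (Suc n - i) :: (_, 'k) mseries) m \<noteq> 0"
    unfolding mcoeff_sum by (rule sum.not_neutral_contains_not_neutral) simp
  obtain u v where m: "m = (u, v)" by force
  from i have "mcoeff (Yser i :: (_, 'k) mseries) u \<noteq> 0" "mcoeff (Yser (Suc n - i) :: (_, 'k) mseries) v \<noteq> 0"
    by (auto simp: mtensor_def m)
  from Y_weight[OF this(1)] Y_weight[OF this(2)] i(1)
  show "(case m of (u, v) \<Rightarrow> sum_list (map Suc u) + sum_list (map Suc v)) = Suc n"
    by (simp add: m)
next
  show "finite {a. Suc a \<le> n}" for n
    by (rule finite_subset[of _ "{..n}"]) auto
qed (simp_all add: zero_prod_def zero_list_def plus_list_def plus_prod_def split: prod.splits)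

text \<open>
  \<open>x_word\<close> sends the word \<open>Y\<^bsub>n\<^sub>m\<^esub> \<cdots> Y\<^bsub>n\<^sub>1\<^esub>\<close> to \<open>X0\<^bsup>n\<^sub>m-1\<^esup> X1 \<cdots> X0\<^bsup>n\<^sub>1-1\<^esup> X1\<close>. It is a bijection onto the
  words not ending in \<open>X0\<close>, so \<open>\<pi>\<^sub>Y\<close> can be given by coefficients.
\<close>

definition x_word :: "nat list \<Rightarrow> xletter list" where
  "x_word ns = concat (map (\<lambda>n. replicate n X0 @ [X1]) ns)"

definition \<pi>\<^sub>Y :: "(xletter list, 'k :: field_char_0) mseries \<Rightarrow> (nat list, 'k) mseries" where
  "\<pi>\<^sub>Y \<phi> = Mseries (\<lambda>ns. (-1) ^ length ns * mcoeff \<phi> (x_word ns))"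

text \<open>The summation index \<open>n\<close> below is the usual one minus 1.\<close>

definition series_corr :: "(xletter list, 'k :: field_char_0) mseries \<Rightarrow> (nat list, 'k) mseries" where
  "series_corr \<phi> = mexp (msum (\<lambda>n. mscale
     ((-1) ^ Suc n / of_nat (Suc n) * mcoeff \<phi> (replicate n X0 @ [X1])) (Yser 1 ^ Suc n)))"

definition series_regularization ::
    "(xletter list, 'k :: field_char_0) mseries \<Rightarrow> (nat list, 'k) mseries" where
  "series_regularization \<phi> = series_corr \<phi> * \<pi>\<^sub>Y \<phi>"

definition generalized_double_shuffle :: "(xletter list, 'k :: field_char_0) mseries \<Rightarrow> bool" where
  "generalized_double_shuffle \<phi> \<longleftrightarrow>
     coprod_star (series_regularization \<phi>) = series_regularization \<phi> \<otimes>\<^sub>m series_regularization \<phi>"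

end

theory Submission
  imports Defs "HOL.Modules" "HOL-Computational_Algebra.Formal_Power_Series"
begin

text \<open>
  Let \<open>s = \<pi>\<^sub>Y \<phi>\<close>. Analytically, \<open>s\<close> is the generating series of the one-variable multiple
  polylogarithms, and the product \<open>s(x) \<otimes> s(y)\<close> is a sum of terms \<open>x\<^sup>m y\<^sup>n\<close>, where \<open>m\<close> and \<open>n\<close> are the
  largest summation indices. Its part with \<open>m > n\<close>, together with \<open>s(xy)\<close>, satisfies a linear
  differential equation on the moduli space of five points whose residues make
  \<open>k\<langle>\<langle>Y\<rangle>\<rangle>\<^sup>\<otimes>\<^sup>2 \<times> k\<langle>\<langle>Y\<rangle>\<rangle>\<close> a module over the braid Lie algebra. Applying the pentagon equation
  to the vector \<open>(0, 1)\<close> of this module compares the two paths from \<open>(0, 0)\<close> to \<open>(1, 1)\<close> and gives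
  \<open>s \<otimes> s = \<Gamma> \<Delta>\<^sub>*(s)\<close>, where \<open>\<Gamma>\<close>, a series in \<open>Y\<^sub>1 \<otimes> 1\<close> and \<open>1 \<otimes> Y\<^sub>1\<close>, comes from the exceptional divisor
  over \<open>(1, 1)\<close>.

  Let \<open>\<partial>\<close> be the derivation with \<open>\<partial> Y\<^sub>n = Y\<^sub>n\<^sub>-\<^sub>1\<close>, so that \<open>(\<partial> \<otimes> 1) \<Delta>\<^sub>* = \<Delta>\<^sub>* \<partial>\<close>. The part of the equation
  that is linear in \<open>Y\<^sub>1 \<otimes> 1\<close> shows that \<open>t = \<phi>\<^sub>c\<^sub>o\<^sub>r\<^sub>r s\<close> satisfies \<open>\<partial> t = \<kappa> t\<close> for a constant \<open>\<kappa>\<close>. Applying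
  \<open>\<partial> \<otimes> 1\<close> to \<open>t \<otimes> t = K \<Delta>\<^sub>*(s)\<close> with \<open>K = (\<phi>\<^sub>c\<^sub>o\<^sub>r\<^sub>r \<otimes> \<phi>\<^sub>c\<^sub>o\<^sub>r\<^sub>r) \<Gamma>\<close> then yields a first-order differential equation
  for \<open>K\<close> that \<open>\<Delta>\<^sub>*(\<phi>\<^sub>c\<^sub>o\<^sub>r\<^sub>r)\<close> satisfies as well. Hence \<open>K = \<Delta>\<^sub>*(\<phi>\<^sub>c\<^sub>o\<^sub>r\<^sub>r)\<close>.
\<close>

section \<open>Representations of presented Lie algebras\<close>

lemma poly_mapping_single_induct [case_names zero single add]:
  fixes p :: "'a \<Rightarrow>\<^sub>0 'b :: ab_group_add"
  assumes "P 0" "\<And>k c. P (Poly_Mapping.single k c)" "\<And>p q. P p \<Longrightarrow> P q \<Longrightarrow> P (p + q)"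
  shows "P p"
proof (induction p rule: update_induct)
  case const
  then show ?case by (rule assms(1))
next
  case (update p a b)
  have "Poly_Mapping.update a b p = p + Poly_Mapping.single a b"
    using update by (intro poly_mapping_eqI)
      (auto simp: lookup_update lookup_add lookup_single when_def in_keys_iff)
  then show ?case using update assms by simp
qed

text \<open>
  A copy of \<^locale>\<open>module\<close>, to which the global interpretations of the latter do not apply.
\<close>

locale word_module = module scale
  for scale :: "'a :: comm_ring_1 \<Rightarrow> 'b :: ab_group_add \<Rightarrow> 'b" (infixr \<open>*s\<close> 75)
begin

definition lin_ext :: "('w \<Rightarrow> 'b) \<Rightarrow> ('w \<Rightarrow>\<^sub>0 'a) \<Rightarrow> 'b" where
  "lin_ext F p = (\<Sum>w\<in>Poly_Mapping.keys p. Poly_Mapping.lookup p w *s F w)"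

lemma lin_ext_superset:
  fixes p :: "'w \<Rightarrow>\<^sub>0 'a"
  shows "finite A \<Longrightarrow> Poly_Mapping.keys p \<subseteq> A \<Longrightarrow> lin_ext F p = (\<Sum>w\<in>A. Poly_Mapping.lookup p w *s F w)"
  unfolding lin_ext_def by (rule sum.mono_neutral_left) (auto simp: in_keys_iff)

lemma lin_ext_zero [simp]: "lin_ext F 0 = 0"
  by (simp add: lin_ext_def)

lemma lin_ext_single [simp]: "lin_ext F (Poly_Mapping.single w c) = c *s F w"
  by (simp add: lin_ext_def)

lemma lin_ext_add [simp]: "lin_ext F (p + q) = lin_ext F p + lin_ext F q"
proof -
  let ?A = "Poly_Mapping.keys p \<union> Poly_Mapping.keys q"
  have "lin_ext F (p + q) = (\<Sum>w\<in>?A. Poly_Mapping.lookup (p + q) w *s F w)"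
    by (rule lin_ext_superset) (auto simp: Poly_Mapping.keys_add)
  also have "\<dots> = lin_ext F p + lin_ext F q"
    by (subst (1 2) lin_ext_superset[of ?A])
      (simp_all add: lookup_add scale_left_distrib sum.distrib)
  finally show ?thesis .
qed

lemma lin_ext_diff [simp]: "lin_ext F (p - q) = lin_ext F p - lin_ext F q"
  by (metis add_diff_cancel_right' diff_add_cancel lin_ext_add)

lemma lin_ext_sum: "lin_ext F (sum p A) = (\<Sum>i\<in>A. lin_ext F (p i))"
  by (induction A rule: infinite_finite_induct) auto

lemma lin_ext_hom:
  assumes "\<And>w. module_hom scale scale (F w)"
  shows "module_hom scale scale (\<lambda>v. lin_ext (\<lambda>w. F w v) p)"
proof -
  interpret module_pair scale scale by unfold_locales
  show ?thesis
    unfolding lin_ext_def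
    by (intro module_hom_sum module_hom_scale assms) (auto simp: module_axioms)
qed

section \<open>Words and truncated series in X0, X1 acting through a pair of operators\<close>

definition xword_act :: "('b \<Rightarrow> 'b) \<Rightarrow> ('b \<Rightarrow> 'b) \<Rightarrow> xletter list \<Rightarrow> 'b \<Rightarrow> 'b" where
  "xword_act P Q W = foldr (\<lambda>a. case a of X0 \<Rightarrow> P | X1 \<Rightarrow> Q) W"

lemma xword_act_simps [simp]:
  "xword_act P Q [] v = v"
  "xword_act P Q (X0 # W) v = P (xword_act P Q W v)"
  "xword_act P Q (X1 # W) v = Q (xword_act P Q W v)"
  "xword_act P Q (V @ W) v = xword_act P Q V (xword_act P Q W v)"
  by (simp_all add: xword_act_def)

text \<open>The cutoff \<open>length W < n\<close> is the one in level \<open>n\<close> of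
  \<open>subst\<close>, so this is the operator \<phi>(P, Q) at that level.\<close>

definition xseries_act ::
    "(xletter list, 'a) mseries \<Rightarrow> nat \<Rightarrow> ('b \<Rightarrow> 'b) \<Rightarrow> ('b \<Rightarrow> 'b) \<Rightarrow> 'b \<Rightarrow> 'b" where
  "xseries_act \<phi> n P Q v = (\<Sum>W | length W < n. mcoeff \<phi> W *s xword_act P Q W v)"

end

lemma finite_xwords: "finite {W :: xletter list. length W < n}"
proof -
  have "(UNIV :: xletter set) = {X0, X1}"
    by (auto intro: xletter.exhaust)
  then have "finite (UNIV :: xletter set)"
    by (metis finite.emptyI finite.insertI)
  from finite_lists_length_le[OF this, of n] show ?thesis
    by (rule rev_finite_subset) auto
qed

text \<open>Only the images of \<open>x\<close> under words are tracked, so \<open>S\<close> need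
  not be a subspace; linearity of \<open>f\<close> then sums the series. The set \<open>S\<close>
  serves \<open>total\<close>, which is compatible with one factor of the pentagon only on certain
  vectors.\<close>

lemma xseries_act_intertwine:
  assumes "module_hom s1 s2 f" and x: "S x"
    and P: "\<And>x. S x \<Longrightarrow> S (P x) \<and> f (P x) = P' (f x)"
    and Q: "\<And>x. S x \<Longrightarrow> S (Q x) \<and> f (Q x) = Q' (f x)"
  shows "f (word_module.xseries_act s1 \<phi> n P Q x) = word_module.xseries_act s2 \<phi> n P' Q' (f x)"
proof -
  interpret module_hom s1 s2 f by fact
  interpret m1: word_module s1 by unfold_locales
  interpret m2: word_module s2 by unfold_locales
  have "S (m1.xword_act P Q W x) \<and> f (m1.xword_act P Q W x) = m2.xword_act P' Q' W (f x)" for W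
  proof (induction W)
    case (Cons a W)
    then show ?case using P Q by (cases a) auto
  qed (use x in auto)
  then show ?thesis
    by (simp add: m1.xseries_act_def m2.xseries_act_def sum scale)
qed

text \<open>Arbitrary linear operators indexed by generators act for the free nonassociative algebra
  through commutators, and from there for the free associative algebra on it. Relations are imposed
  only afterwards.\<close>

locale generator_action = word_module scale
  for scale :: "'k :: field_char_0 \<Rightarrow> 'v :: ab_group_add \<Rightarrow> 'v" (infixr \<open>*s\<close> 75) +
  fixes T :: "'g \<Rightarrow> 'v \<Rightarrow> 'v"
  assumes T_hom: "module_hom scale scale (T g)"
begin

primrec magma_act :: "'g magma \<Rightarrow> 'v \<Rightarrow> 'v" where
  "magma_act (Gen g) = T g"
| "magma_act (Mul s t) = (\<lambda>v. magma_act s (magma_act t v) - magma_act t (magma_act s v))"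

definition lie_act :: "('g, 'k) nonassoc \<Rightarrow> 'v \<Rightarrow> 'v" where
  "lie_act x v = lin_ext (\<lambda>t. magma_act t v) x"

primrec word_act :: "('g, 'k) nonassoc list \<Rightarrow> 'v \<Rightarrow> 'v" where
  "word_act [] = (\<lambda>v. v)"
| "word_act (x # w) = (\<lambda>v. lie_act x (word_act w v))"

definition env_act :: "('g, 'k) env_rep \<Rightarrow> 'v \<Rightarrow> 'v" where
  "env_act p v = lin_ext (\<lambda>w. word_act w v) p"

lemma magma_act_hom: "module_hom scale scale (magma_act t)"
proof (induction t)
  case (Mul s t)
  interpret module_pair scale scale by unfold_locales
  note st = module_hom_compose[OF Mul(1) Mul(2)] module_hom_compose[OF Mul(2) Mul(1)]
  show ?case
    using module_hom_sub[OF st(2) st(1)] by (simp add: o_def)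
qed (simp add: T_hom)

lemma lie_act_hom: "module_hom scale scale (lie_act x)"
  using lin_ext_hom[of magma_act, OF magma_act_hom] by (simp add: lie_act_def[abs_def])

lemma word_act_hom: "module_hom scale scale (word_act w)"
proof (induction w)
  case (Cons x w)
  with module_hom_compose[OF Cons lie_act_hom] show ?case by (simp add: o_def)
qed (simp add: module_hom_ident)

lemma env_act_hom: "module_hom scale scale (env_act p)"
  using lin_ext_hom[of word_act, OF word_act_hom] by (simp add: env_act_def[abs_def])

lemmas lie_act_linear =
  module_hom.add[OF lie_act_hom] module_hom.diff[OF lie_act_hom]
  module_hom.scale[OF lie_act_hom] module_hom.zero[OF lie_act_hom]

lemmas env_act_linear =
  module_hom.add[OF env_act_hom] module_hom.diff[OF env_act_hom]
  module_hom.scale[OF env_act_hom] module_hom.zero[OF env_act_hom]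

lemma lie_act_simps [simp]:
  "lie_act 0 v = 0"
  "lie_act (x + y) v = lie_act x v + lie_act y v"
  "lie_act (x - y) v = lie_act x v - lie_act y v"
  "lie_act (gen g) v = T g v"
  by (simp_all add: lie_act_def gen_def)

lemma lie_act_nscale [simp]: "lie_act (nscale c x) v = c *s lie_act x v"
proof -
  have "Poly_Mapping.keys (nscale c x) \<subseteq> Poly_Mapping.keys x"
    by (auto simp: nscale_def in_keys_iff map.rep_eq when_def)
  then have "lie_act (nscale c x) v =
      (\<Sum>t\<in>Poly_Mapping.keys x. Poly_Mapping.lookup (nscale c x) t *s magma_act t v)"
    unfolding lie_act_def by (intro lin_ext_superset) auto
  then show ?thesis
    by (simp add: lie_act_def lin_ext_def nscale_def map.rep_eq scale_sum_right in_keys_iff when_def)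
qed

lemma lie_act_bracket [simp]:
  "lie_act (bracket x y) v = lie_act x (lie_act y v) - lie_act y (lie_act x v)"
proof -
  interpret h: module_hom scale scale "magma_act t" for t by (rule magma_act_hom)
  let ?l = "Poly_Mapping.lookup"
  have "lie_act (bracket x y) v = (\<Sum>s\<in>Poly_Mapping.keys x. \<Sum>t\<in>Poly_Mapping.keys y.
      (?l x s * ?l y t) *s magma_act s (magma_act t v) - (?l x s * ?l y t) *s magma_act t (magma_act s v))"
    by (simp add: lie_act_def bracket_def lin_ext_sum scale_right_diff_distrib)
  moreover have "(\<Sum>s\<in>Poly_Mapping.keys x. \<Sum>t\<in>Poly_Mapping.keys y.
      (?l x s * ?l y t) *s magma_act s (magma_act t v)) = lie_act x (lie_act y v)"
    by (simp add: lie_act_def lin_ext_def h.sum h.scale scale_sum_right)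
  moreover have "(\<Sum>s\<in>Poly_Mapping.keys x. \<Sum>t\<in>Poly_Mapping.keys y.
      (?l x s * ?l y t) *s magma_act t (magma_act s v)) = lie_act y (lie_act x v)"
    unfolding lie_act_def lin_ext_def h.sum h.scale scale_sum_right
    by (subst sum.swap) (simp add: mult.commute)
  ultimately show ?thesis
    by (simp add: sum_subtractf)
qed

lemma env_act_simps [simp]:
  "env_act 0 v = 0"
  "env_act (p + q) v = env_act p v + env_act q v"
  "env_act (p - q) v = env_act p v - env_act q v"
  "env_act (env x) v = lie_act x v"
  "env_act (env_const c) v = c *s v"
  by (simp_all add: env_act_def env_def env_const_def)

lemma word_act_append: "word_act (u @ w) v = word_act u (word_act w v)"
  by (induction u) auto

lemma env_act_mult [simp]: "env_act (p * q) v = env_act p (env_act q v)"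
proof (induction p rule: poly_mapping_single_induct)
  case (single u c)
  show ?case
  proof (induction q rule: poly_mapping_single_induct)
    case zero
    show ?case by (simp add: env_act_linear)
  next
    case (single w d)
    show ?case
      by (simp add: env_act_def mult_single plus_list_def word_act_append
          module_hom.scale[OF word_act_hom])
  next
    case (add p q)
    then show ?case by (simp add: ring_distribs env_act_linear)
  qed
qed (simp_all add: ring_distribs)

lemma env_act_sum: "env_act (sum p A) v = (\<Sum>i\<in>A. env_act (p i) v)"
  by (simp add: env_act_def lin_ext_sum)

lemma env_act_one [simp]: "env_act 1 v = v"
  using env_act_simps(5)[of 1 v] by (simp add: env_const_def flip: zero_list_def)

lemma env_act_subst:
  "env_act (subst \<phi> x y n) v = xseries_act \<phi> n (lie_act x) (lie_act y) v"
proof -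
  have "env_act (prod_list (map (\<lambda>a. env (case a of X0 \<Rightarrow> x | X1 \<Rightarrow> y)) W)) v =
      xword_act (lie_act x) (lie_act y) W v" for W
  proof (induction W)
    case (Cons a W)
    then show ?case by (cases a) auto
  qed simp
  then show ?thesis
    by (simp add: subst_def xseries_act_def env_act_sum)
qed

context
  fixes R assumes relations: "\<And>r v. r \<in> R \<Longrightarrow> lie_act r v = 0"
begin

text \<open>Commutators of operators are alternating and satisfy the Jacobi identity, so it suffices
  that the relations act as zero.\<close>

lemma lie_act_ideal: "x \<in> lie_ideal R \<Longrightarrow> lie_act x v = 0"
proof (induction x arbitrary: v rule: lie_ideal.induct)
  case (jacobi x y z)
  show ?case by (simp add: lie_act_linear)
qed (auto simp: relations lie_act_linear)

lemma env_act_ideal: "p \<in> env_ideal R \<Longrightarrow> env_act p v = 0"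
proof (induction p arbitrary: v rule: env_ideal.induct)
  case (cong x y)
  then show ?case using lie_act_ideal[of "x - y" v] by simp
qed (auto simp: env_act_linear)

text \<open>Turns congruence at level \<open>n\<close> of the completion into congruence modulo
  \<open>Fil n\<close>: the ideal acts as zero, and a monomial in at least \<open>n\<close>
  generators raises the degree at least \<open>n\<close> times.\<close>

lemma env_act_filtration:
  fixes Fil :: "nat \<Rightarrow> 'v set"
  assumes Fil: "\<And>n. 0 \<in> Fil n" "\<And>n x y. x \<in> Fil n \<Longrightarrow> y \<in> Fil n \<Longrightarrow> x + y \<in> Fil n"
      "\<And>n c x. x \<in> Fil n \<Longrightarrow> c *s x \<in> Fil n" "Fil 0 = UNIV" "\<And>n x. x \<in> Fil (Suc n) \<Longrightarrow> x \<in> Fil n"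
      "\<And>n x g. x \<in> Fil n \<Longrightarrow> T g x \<in> Fil (Suc n)"
    and "p \<in> env_filtration R n"
  shows "env_act p v \<in> Fil n"
  using assms(7)
proof (induction p rule: env_filtration.induct)
  case (ideal p)
  then show ?case by (simp add: env_act_ideal Fil)
next
  case (monomial gs c)
  have antimono: "x \<in> Fil (n + m) \<Longrightarrow> x \<in> Fil n" for x n m
    by (induction m) (use Fil(5) in auto)
  have "env_act (prod_list (map (\<lambda>g. env (gen g)) gs)) v \<in> Fil (length gs)"
    by (induction gs) (use Fil in auto)
  with monomial antimono[of _ n "length gs - n"] Fil(3) show ?case by simp
qed (simp add: Fil)

end

end

section \<open>Coefficients of products and tensor products of series\<close>

lemma mcoeff_mscale [simp]: "mcoeff (mscale c f) w = c * mcoeff f w"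
  by (simp add: mscale_def)

interpretation mseries: word_module "mscale :: 'k :: comm_ring_1 \<Rightarrow> ('m, 'k) mseries \<Rightarrow> ('m, 'k) mseries"
  by standard (auto intro!: mseries_eqI simp: algebra_simps)

lemma mscale_mult_left [simp]:
  "mscale c f * g = mscale c (f * g)" for f g :: "('m :: finite_split_monoid, 'k :: comm_ring_1) mseries"
  by (rule mseries_eqI) (simp add: times_mseries.rep_eq sum_distrib_left case_prod_unfold mult_ac)

lemma mscale_mult_right [simp]:
  "f * mscale c g = mscale c (f * g)" for f g :: "('m :: finite_split_monoid, 'k :: comm_ring_1) mseries"
  by (rule mseries_eqI) (simp add: times_mseries.rep_eq sum_distrib_left case_prod_unfold mult_ac)

lemma mcoeff_tensor [simp]: "mcoeff (f \<otimes>\<^sub>m g) (u, v) = mcoeff f u * mcoeff g v"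
  by (simp add: mtensor_def)

lemma mcoeff_mletter [simp]: "mcoeff (mletter a) w = (if w = [a] then 1 else 0)"
  by (simp add: mletter_def)

lemma mcoeff_one: "mcoeff 1 w = (if w = 0 then 1 else 0)"
  by (simp add: one_mseries.rep_eq)

lemma mcoeff_one_list [simp]: "mcoeff 1 w = (if w = [] then 1 else 0)"
  by (simp add: mcoeff_one zero_list_def)

lemma mcoeff_one_pair [simp]: "mcoeff 1 (u, v) = (if u = [] \<and> v = [] then 1 else 0)"
  by (simp add: mcoeff_one zero_list_def zero_prod_def)

lemma splits_Nil: "{(u, v). u + v = ([] :: 'a list)} = {([], [])}"
  by (auto simp: plus_list_def)

lemma splits_Cons:
  "{(u, v). u + v = a # w} = insert ([], a # w) ((\<lambda>(u, v). (a # u, v)) ` {(u, v). u + v = w})"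
  by (auto simp: plus_list_def image_iff append_eq_Cons_conv)

lemmas finite_splits' = finite_splits[unfolded case_prod_unfold]

lemma sum_splits_Nil: "(\<Sum>(u, v)\<in>{(u, v). u + v = ([] :: 'a list)}. f u v) = f [] []"
  by (simp add: splits_Nil)

lemma sum_splits_Cons:
  "(\<Sum>(u, v)\<in>{(u, v). u + v = a # w}. f u v) =
     f [] (a # w) + (\<Sum>(u, v)\<in>{(u, v). u + v = w}. f (a # u) v)"
  by (subst splits_Cons, subst sum.insert)
    (auto simp: finite_splits' sum.reindex inj_on_def case_prod_unfold)

text \<open>A series is its constant term plus the sum of all
  \<open>mletter a * quot_left a f\<close>; the recursions for coproducts rest on this
  decomposition.\<close>

definition quot_left :: "'a \<Rightarrow> ('a list, 'k) mseries \<Rightarrow> ('a list, 'k) mseries" where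
  "quot_left a f = Mseries (\<lambda>w. mcoeff f (a # w))"

lemma mcoeff_quot_left [simp]: "mcoeff (quot_left a f) w = mcoeff f (a # w)"
  by (simp add: quot_left_def)

definition fix_fst :: "'m \<Rightarrow> ('m \<times> 'n, 'k) mseries \<Rightarrow> ('n, 'k) mseries" where
  "fix_fst u F = Mseries (\<lambda>v. mcoeff F (u, v))"

definition fix_snd :: "'n \<Rightarrow> ('m \<times> 'n, 'k) mseries \<Rightarrow> ('m, 'k) mseries" where
  "fix_snd v F = Mseries (\<lambda>u. mcoeff F (u, v))"

lemma mcoeff_fix [simp]:
  "mcoeff (fix_fst u F) v = mcoeff F (u, v)" "mcoeff (fix_snd v F) u = mcoeff F (u, v)"
  by (simp_all add: fix_fst_def fix_snd_def)

lemma mcoeff_times_pair: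
  fixes F G :: "('m :: finite_split_monoid \<times> 'n :: finite_split_monoid, 'k :: ring_1) mseries"
  shows "mcoeff (F * G) (u, v) = (\<Sum>(u1, u2)\<in>{(u1, u2). u1 + u2 = u}. \<Sum>(v1, v2)\<in>{(v1, v2). v1 + v2 = v}.
    mcoeff F (u1, v1) * mcoeff G (u2, v2))"
proof -
  let ?S = "\<lambda>u. {(u1, u2). u1 + u2 = u}"
  have "(\<Sum>(u1, u2)\<in>?S u. \<Sum>(v1, v2)\<in>?S v. mcoeff F (u1, v1) * mcoeff G (u2, v2)) =
      (\<Sum>(p, q)\<in>?S u \<times> ?S v. mcoeff F (fst p, fst q) * mcoeff G (snd p, snd q))"
    by (simp add: case_prod_unfold sum.cartesian_product)
  also have "\<dots> = mcoeff (F * G) (u, v)"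
    unfolding times_mseries.rep_eq
    by (rule sum.reindex_bij_witness[where
          i = "\<lambda>((a, b), (c, d)). ((a, c), (b, d))" and j = "\<lambda>((a, b), (c, d)). ((a, c), (b, d))"]) auto
  finally show ?thesis by simp
qed

lemma fix_fst_times:
  fixes F G :: "('m :: finite_split_monoid \<times> 'n :: finite_split_monoid, 'k :: ring_1) mseries"
  shows "fix_fst u (F * G) = (\<Sum>(u1, u2)\<in>{(u1, u2). u1 + u2 = u}. fix_fst u1 F * fix_fst u2 G)"
proof (rule mseries_eqI)
  fix v
  show "mcoeff (fix_fst u (F * G)) v =
    mcoeff (\<Sum>(u1, u2)\<in>{(u1, u2). u1 + u2 = u}. fix_fst u1 F * fix_fst u2 G) v"
    unfolding mcoeff_fix mcoeff_times_pair
    by (simp add: mcoeff_sum case_prod_unfold times_mseries.rep_eq)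
qed

lemma fix_snd_times:
  fixes F G :: "('m :: finite_split_monoid \<times> 'n :: finite_split_monoid, 'k :: ring_1) mseries"
  shows "fix_snd v (F * G) = (\<Sum>(v1, v2)\<in>{(v1, v2). v1 + v2 = v}. fix_snd v1 F * fix_snd v2 G)"
proof (rule mseries_eqI)
  fix u
  show "mcoeff (fix_snd v (F * G)) u =
    mcoeff (\<Sum>(v1, v2)\<in>{(v1, v2). v1 + v2 = v}. fix_snd v1 F * fix_snd v2 G) u"
    unfolding mcoeff_fix mcoeff_times_pair
    by (simp add: mcoeff_sum case_prod_unfold times_mseries.rep_eq) (rule sum.swap)
qed

lemma tensor_times:
  fixes f f' :: "('a list, 'k :: comm_ring_1) mseries" and g g' :: "('b list, 'k) mseries"
  shows "(f \<otimes>\<^sub>m g) * (f' \<otimes>\<^sub>m g') = (f * f') \<otimes>\<^sub>m (g * g')"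
proof (rule mseries_eqI, clarify)
  fix u v
  show "mcoeff ((f \<otimes>\<^sub>m g) * (f' \<otimes>\<^sub>m g')) (u, v) = mcoeff ((f * f') \<otimes>\<^sub>m (g * g')) (u, v)"
    by (simp add: mcoeff_times_pair) (simp add: times_mseries.rep_eq sum_product case_prod_unfold mult_ac)
qed

lemma tensor_one [simp]: "1 \<otimes>\<^sub>m 1 = 1"
  by (rule mseries_eqI) auto

lemma mcoeff_times_delta:
  fixes f :: "('m :: finite_split_monoid, 'k :: ring_1) mseries"
  assumes "\<And>p. mcoeff f p = (if p = p0 then 1 else 0)"
  shows "mcoeff (f * g) x = (\<Sum>q | p0 + q = x. mcoeff g q)"
proof -
  have "mcoeff (f * g) x = (\<Sum>(p, q)\<in>{(p, q). p + q = x \<and> p = p0}. mcoeff f p * mcoeff g q)"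
    unfolding times_mseries.rep_eq by (rule sum.mono_neutral_right) (auto simp: assms finite_splits split: if_splits)
  also have "\<dots> = (\<Sum>q | p0 + q = x. mcoeff g q)"
    by (rule sum.reindex_bij_witness[where i = "\<lambda>q. (p0, q)" and j = snd]) (auto simp: assms)
  finally show ?thesis .
qed

lemma mcoeff_mletter_times [simp]:
  "mcoeff (mletter a * f) [] = 0"
  "mcoeff (mletter a * f) (b # w) = (if b = a then mcoeff f w else 0)"
proof -
  have "{q. [a] + q = []} = {}" "{q. [a] + q = b # w} = (if b = a then {w} else {})"
    by (auto simp: plus_list_def)
  then show "mcoeff (mletter a * f) [] = 0" "mcoeff (mletter a * f) (b # w) = (if b = a then mcoeff f w else 0)"
    by (simp_all add: mcoeff_times_delta[of _ "[a]"])
qed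

lemma mcoeff_mletter_tensor_one_times [simp]:
  fixes F :: "('a list \<times> 'b list, 'k :: comm_ring_1) mseries"
  shows "mcoeff ((mletter a \<otimes>\<^sub>m 1) * F) ([], v) = 0"
    "mcoeff ((mletter a \<otimes>\<^sub>m 1) * F) (b # u, v) = (if b = a then mcoeff F (u, v) else 0)"
proof -
  have *: "mcoeff ((mletter a \<otimes>\<^sub>m 1) * F) x = (\<Sum>q | ([a], []) + q = x. mcoeff F q)" for x
    by (rule mcoeff_times_delta) (auto simp: mtensor_def split: if_splits)
  have sets: "{q. ([a], [] :: 'b list) + q = ([], v)} = {}"
    "{q. ([a], []) + q = (b # u, v)} = (if b = a then {(u, v)} else {})"
    by (auto simp: plus_list_def)
  then show "mcoeff ((mletter a \<otimes>\<^sub>m 1) * F) ([], v) = 0"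
    "mcoeff ((mletter a \<otimes>\<^sub>m 1) * F) (b # u, v) = (if b = a then mcoeff F (u, v) else 0)"
    by (simp_all only: * sets sum.empty) simp_all
qed

lemma mcoeff_one_tensor_mletter_times [simp]:
  fixes F :: "('a list \<times> 'b list, 'k :: comm_ring_1) mseries"
  shows "mcoeff ((1 \<otimes>\<^sub>m mletter a) * F) (u, []) = 0"
    "mcoeff ((1 \<otimes>\<^sub>m mletter a) * F) (u, b # v) = (if b = a then mcoeff F (u, v) else 0)"
proof -
  have *: "mcoeff ((1 \<otimes>\<^sub>m mletter a) * F) x = (\<Sum>q | ([], [a]) + q = x. mcoeff F q)" for x
    by (rule mcoeff_times_delta) (auto simp: mtensor_def split: if_splits)
  have sets: "{q. ([] :: 'a list, [a]) + q = (u, [])} = {}"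
    "{q. ([], [a]) + q = (u, b # v)} = (if b = a then {(u, v)} else {})"
    by (auto simp: plus_list_def)
  then show "mcoeff ((1 \<otimes>\<^sub>m mletter a) * F) (u, []) = 0"
    "mcoeff ((1 \<otimes>\<^sub>m mletter a) * F) (u, b # v) = (if b = a then mcoeff F (u, v) else 0)"
    by (simp_all only: * sets sum.empty) simp_all
qed

lemma mletter_tensor_mletter:
  "mletter a \<otimes>\<^sub>m mletter b = (mletter a \<otimes>\<^sub>m 1) * (1 \<otimes>\<^sub>m mletter b :: (_, 'k :: comm_ring_1) mseries)"
  by (simp add: tensor_times)

section \<open>Continuous homomorphisms\<close>

context
  fixes \<delta> :: "'a \<Rightarrow> ('m :: finite_split_monoid, 'k :: comm_ring_1) mseries"
  assumes locally_finite: "\<And>m. finite {w. mcoeff (prod_list (map \<delta> w)) m \<noteq> 0}"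
begin

lemma mcoeff_continuous_hom:
  assumes "finite A" "{w. mcoeff (prod_list (map \<delta> w)) m \<noteq> 0} \<subseteq> A"
  shows "mcoeff (continuous_hom \<delta> f) m = (\<Sum>w\<in>A. mcoeff f w * mcoeff (prod_list (map \<delta> w)) m)"
  unfolding continuous_hom_def msum_def mcoeff_Mseries mcoeff_mscale
  by (rule Sum_any.expand_superset) (use assms in auto)

lemma module_hom_continuous_hom: "module_hom mscale mscale (continuous_hom \<delta>)"
  by standard
    (auto intro!: mseries_eqI simp: mcoeff_continuous_hom[OF locally_finite order_refl]
      sum.distrib sum_distrib_left algebra_simps)

text \<open>Both sides reduce to one finite double sum over words: images of words are
  multiplicative under concatenation, and local finiteness bounds the words that matter at
  \<open>m\<close>.\<close>

lemma continuous_hom_times: "continuous_hom \<delta> (f * g) = continuous_hom \<delta> f * continuous_hom \<delta> g"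
proof (rule mseries_eqI)
  fix m :: 'm
  let ?e = "\<lambda>w. prod_list (map \<delta> w)"
  let ?S = "{(p, q). p + q = m}"
  \<comment> \<open>\<open>B\<close> holds all words whose image meets a left or right factor of
    \<open>m\<close>; pairs outside \<open>B \<times> B\<close> contribute nothing at
    \<open>m\<close>.\<close>
  define B where "B = (\<Union>(p, q)\<in>?S. {w. mcoeff (?e w) p \<noteq> 0} \<union> {w. mcoeff (?e w) q \<noteq> 0})"
  have B: "finite B"
    unfolding B_def using locally_finite by (auto simp: finite_splits' case_prod_unfold)
  \<comment> \<open>All concatenations of words of \<open>B\<close> are included, so that regrouping
    pairs by their concatenation loses no term.\<close>
  define A where "A = (\<lambda>(u, v). u + v) ` (B \<times> B) \<union> {w. mcoeff (?e w) m \<noteq> 0}"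
  have A: "finite A"
    unfolding A_def using B locally_finite by auto
  define P where "P = (SIGMA w:A. {(u, v). u + v = w})"
  define h where "h = (\<lambda>u v. mcoeff f u * mcoeff g v * mcoeff (?e (u + v)) m)"
  have e_add: "?e (u + v) = ?e u * ?e v" for u v
    by (simp add: plus_list_def)
  have zero: "h u v = 0" if "\<not> (u \<in> B \<and> v \<in> B)" for u v
  proof -
    have "mcoeff (?e u) p * mcoeff (?e v) q = 0" if "p + q = m" for p q
      using \<open>\<not> (u \<in> B \<and> v \<in> B)\<close> that unfolding B_def by force
    then have "mcoeff (?e (u + v)) m = 0"
      unfolding e_add times_mseries.rep_eq by (intro sum.neutral) auto
    then show ?thesis by (simp add: h_def)
  qed
  have "mcoeff (continuous_hom \<delta> (f * g)) m = (\<Sum>w\<in>A. \<Sum>(u, v)\<in>{(u, v). u + v = w}. h u v)"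
    by (subst mcoeff_continuous_hom[OF A])
      (auto simp: A_def h_def times_mseries.rep_eq sum_distrib_right case_prod_unfold intro!: sum.cong)
  also have "\<dots> = (\<Sum>(w, u, v)\<in>P. h u v)"
    unfolding P_def by (subst sum.Sigma) (auto simp: A finite_splits' case_prod_unfold)
  also have "\<dots> = (\<Sum>(w, u, v)\<in>{(w, u, v). u \<in> B \<and> v \<in> B \<and> w = u + v}. h u v)"
    by (rule sum.mono_neutral_right)
      (auto simp: P_def A finite_splits A_def[symmetric] intro!: zero, auto simp: A_def)
  also have "\<dots> = (\<Sum>(u, v)\<in>B \<times> B. h u v)"
    by (rule sum.reindex_bij_witness[where i = "\<lambda>(u, v). (u + v, u, v)" and j = snd]) auto
  also have "\<dots> = (\<Sum>(u, v)\<in>B \<times> B. \<Sum>(p, q)\<in>?S.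
      (mcoeff f u * mcoeff (?e u) p) * (mcoeff g v * mcoeff (?e v) q))"
    unfolding h_def e_add times_mseries.rep_eq by (simp add: sum_distrib_left case_prod_unfold mult_ac)
  also have "\<dots> = (\<Sum>(p, q)\<in>?S. \<Sum>(u, v)\<in>B \<times> B.
      (mcoeff f u * mcoeff (?e u) p) * (mcoeff g v * mcoeff (?e v) q))"
    unfolding case_prod_unfold by (rule sum.swap)
  also have "\<dots> = (\<Sum>(p, q)\<in>?S. (\<Sum>u\<in>B. mcoeff f u * mcoeff (?e u) p) * (\<Sum>v\<in>B. mcoeff g v * mcoeff (?e v) q))"
    by (simp add: sum_product sum.cartesian_product)
  also have "\<dots> = (\<Sum>(p, q)\<in>?S. mcoeff (continuous_hom \<delta> f) p * mcoeff (continuous_hom \<delta> g) q)"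
  proof (rule sum.cong[OF refl], clarify)
    fix p q assume "m = p + q"
    then have "{w. mcoeff (?e w) p \<noteq> 0} \<subseteq> B" "{w. mcoeff (?e w) q \<noteq> 0} \<subseteq> B"
      unfolding B_def by auto
    then show "(\<Sum>u\<in>B. mcoeff f u * mcoeff (?e u) p) * (\<Sum>v\<in>B. mcoeff g v * mcoeff (?e v) q) =
        mcoeff (continuous_hom \<delta> f) p * mcoeff (continuous_hom \<delta> g) q"
      by (simp add: mcoeff_continuous_hom[OF B])
  qed
  also have "\<dots> = mcoeff (continuous_hom \<delta> f * continuous_hom \<delta> g) m"
    by (simp add: times_mseries.rep_eq)
  finally show "mcoeff (continuous_hom \<delta> (f * g)) m = mcoeff (continuous_hom \<delta> f * continuous_hom \<delta> g) m" .
qed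

text \<open>Splits off the first letter of \<open>f\<close>. The set \<open>K\<close> holds the
  letters that can contribute at \<open>m\<close> and keeps the sum finite for an infinite
  alphabet.\<close>

lemma mcoeff_continuous_hom_rec:
  assumes "finite K" and K: "\<And>k g. k \<notin> K \<Longrightarrow> mcoeff (\<delta> k * g) m = 0"
  shows "mcoeff (continuous_hom \<delta> f) m =
    mcoeff f [] * mcoeff 1 m + (\<Sum>k\<in>K. mcoeff (\<delta> k * continuous_hom \<delta> (quot_left k f)) m)"
proof -
  let ?e = "\<lambda>w. prod_list (map \<delta> w)"
  let ?S = "{(p, q). p + q = m}"
  define B where "B = (\<Union>(p, q)\<in>?S. {w. mcoeff (?e w) q \<noteq> 0})"
  have B: "finite B"
    unfolding B_def using locally_finite by (auto simp: finite_splits' case_prod_unfold)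
  have "?e w = \<delta> k * ?e w'" if "w = k # w'" for w k w'
    using that by simp
  have notB: "mcoeff (\<delta> k * ?e w) m = 0" if "w \<notin> B" for k w
  proof -
    have "mcoeff (?e w) q = 0" if "p + q = m" for p q
      using \<open>w \<notin> B\<close> that unfolding B_def by auto
    then show ?thesis
      unfolding times_mseries.rep_eq by (intro sum.neutral) auto
  qed
  let ?A = "insert [] ((\<lambda>(k, w). k # w) ` (K \<times> B))"
  have sub: "{w. mcoeff (?e w) m \<noteq> 0} \<subseteq> ?A"
  proof
    fix w assume w: "w \<in> {w. mcoeff (?e w) m \<noteq> 0}"
    show "w \<in> ?A"
    proof (cases w)
      case (Cons k w')
      with w K[of k "?e w'"] notB[of w' k] have "k \<in> K" "w' \<in> B" by auto
      with Cons show ?thesis by auto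
    qed simp
  qed
  have "mcoeff (continuous_hom \<delta> f) m = (\<Sum>w\<in>?A. mcoeff f w * mcoeff (?e w) m)"
    by (rule mcoeff_continuous_hom[OF _ sub]) (use assms B in auto)
  also have "\<dots> = mcoeff f [] * mcoeff 1 m + (\<Sum>(k, w)\<in>K \<times> B. mcoeff f (k # w) * mcoeff (\<delta> k * ?e w) m)"
    by (subst sum.insert)
      (use assms B in \<open>auto simp: sum.reindex inj_on_def case_prod_unfold\<close>)
  also have "(\<Sum>(k, w)\<in>K \<times> B. mcoeff f (k # w) * mcoeff (\<delta> k * ?e w) m) =
      (\<Sum>k\<in>K. \<Sum>w\<in>B. mcoeff f (k # w) * mcoeff (\<delta> k * ?e w) m)"
    by (simp add: sum.cartesian_product)
  also have "(\<lambda>k. \<Sum>w\<in>B. mcoeff f (k # w) * mcoeff (\<delta> k * ?e w) m) =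
      (\<lambda>k. mcoeff (\<delta> k * continuous_hom \<delta> (quot_left k f)) m)"
  proof
    fix k
    have "(\<Sum>w\<in>B. mcoeff f (k # w) * mcoeff (\<delta> k * ?e w) m) =
        (\<Sum>(p, q)\<in>?S. mcoeff (\<delta> k) p * (\<Sum>w\<in>B. mcoeff (quot_left k f) w * mcoeff (?e w) q))"
      unfolding times_mseries.rep_eq sum_distrib_left case_prod_unfold mcoeff_quot_left
      by (subst sum.swap) (simp add: mult_ac)
    also have "\<dots> = (\<Sum>(p, q)\<in>?S. mcoeff (\<delta> k) p * mcoeff (continuous_hom \<delta> (quot_left k f)) q)"
    proof (rule sum.cong[OF refl], clarify)
      fix p q assume "m = p + q"
      then have "{w. mcoeff (?e w) q \<noteq> 0} \<subseteq> B"
        unfolding B_def by auto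
      then show "mcoeff (\<delta> k) p * (\<Sum>w\<in>B. mcoeff (quot_left k f) w * mcoeff (?e w) q) =
          mcoeff (\<delta> k) p * mcoeff (continuous_hom \<delta> (quot_left k f)) q"
        by (simp add: mcoeff_continuous_hom[OF B])
    qed
    finally show "(\<Sum>w\<in>B. mcoeff f (k # w) * mcoeff (\<delta> k * ?e w) m) =
        mcoeff (\<delta> k * continuous_hom \<delta> (quot_left k f)) m"
      by (simp add: times_mseries.rep_eq)
  qed
  finally show ?thesis .
qed

end

section \<open>The harmonic coproduct\<close>

type_synonym 'k yseries = "(nat list, 'k) mseries"
type_synonym 'k yyseries = "(nat list \<times> nat list, 'k) mseries"

definition coprod_Y :: "nat \<Rightarrow> 'k :: field_char_0 yyseries" where
  "coprod_Y k = (\<Sum>i\<le>Suc k. Yser i \<otimes>\<^sub>m Yser (Suc k - i))"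

lemma coprod_star_eq: "coprod_star = continuous_hom coprod_Y"
  by (simp add: coprod_star_def coprod_Y_def[abs_def])

lemma coprod_Y_locally_finite:
  "finite {w. mcoeff (prod_list (map (coprod_Y :: nat \<Rightarrow> 'k :: field_char_0 yyseries) w)) m \<noteq> 0}"
  using coprod_star_locally_finite[where 'k = 'k] by (simp add: coprod_Y_def[abs_def])

lemma coprod_Y_eq:
  "coprod_Y k = 1 \<otimes>\<^sub>m mletter k + mletter k \<otimes>\<^sub>m 1 + (\<Sum>i<k. mletter i \<otimes>\<^sub>m mletter (k - Suc i))"
proof -
  have *: "Yser (k - i) = mletter (k - Suc i)" if "i < k" for i
    using that by (metis Suc_diff_Suc Yser.simps(2))
  have "coprod_Y k = 1 \<otimes>\<^sub>m mletter k + (\<Sum>i\<le>k. mletter i \<otimes>\<^sub>m Yser (k - i))"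
    by (simp add: coprod_Y_def sum.atMost_Suc_shift del: sum.atMost_Suc)
  also have "(\<Sum>i\<le>k. mletter i \<otimes>\<^sub>m Yser (k - i)) =
      mletter k \<otimes>\<^sub>m 1 + (\<Sum>i<k. mletter i \<otimes>\<^sub>m Yser (k - i))"
    by (simp flip: lessThan_Suc_atMost)
  finally show ?thesis by (simp add: * add.assoc)
qed

text \<open>The letter \<open>n\<close> is Y_(n+1), and Y_(m+1) \<otimes> Y_(n+1) occurs only in the
  coproduct of Y_(m+n+2), which is the letter \<open>Suc (m + n)\<close>.\<close>

lemma mcoeff_coprod_Y_times:
  fixes F :: "'k :: field_char_0 yyseries"
  shows "mcoeff (coprod_Y k * F) ([], []) = 0"
    "mcoeff (coprod_Y k * F) ([], n # v) = (if k = n then mcoeff F ([], v) else 0)"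
    "mcoeff (coprod_Y k * F) (m # u, []) = (if k = m then mcoeff F (u, []) else 0)"
    "mcoeff (coprod_Y k * F) (m # u, n # v) = (if k = m then mcoeff F (u, n # v) else 0) +
       (if k = n then mcoeff F (m # u, v) else 0) + (if k = Suc (m + n) then mcoeff F (u, v) else 0)"
proof -
  have eq: "coprod_Y k * F = (1 \<otimes>\<^sub>m mletter k) * F + (mletter k \<otimes>\<^sub>m 1) * F +
      (\<Sum>i<k. (mletter i \<otimes>\<^sub>m 1) * ((1 \<otimes>\<^sub>m mletter (k - Suc i)) * F))"
    unfolding coprod_Y_eq by (subst mletter_tensor_mletter) (simp add: ring_distribs sum_distrib_right mult.assoc)
  have "(\<Sum>i<k. if m = i then if n = k - Suc i then mcoeff F (u, v) else 0 else 0) =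
      (if k = Suc (m + n) then mcoeff F (u, v) else 0)"
    by (subst sum.delta') auto
  then show "mcoeff (coprod_Y k * F) (m # u, n # v) = (if k = m then mcoeff F (u, n # v) else 0) +
       (if k = n then mcoeff F (m # u, v) else 0) + (if k = Suc (m + n) then mcoeff F (u, v) else 0)"
    by (auto simp: eq mcoeff_sum)
qed (auto simp: mcoeff_sum coprod_Y_eq ring_distribs sum_distrib_right mletter_tensor_mletter[of _ "_ :: nat"] mult.assoc)

lemma mcoeff_coprod_star_Nil_left [simp]: "mcoeff (coprod_star f) ([], v) = mcoeff f v"
proof (induction v arbitrary: f)
  case Nil
  show ?case
    using mcoeff_continuous_hom_rec[OF coprod_Y_locally_finite, of "{}" "([], [])" f]
    by (simp add: coprod_star_eq mcoeff_coprod_Y_times)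
next
  case (Cons n v)
  then show ?case
    using mcoeff_continuous_hom_rec[OF coprod_Y_locally_finite, of "{n}" "([], n # v)" f]
    by (simp add: coprod_star_eq mcoeff_coprod_Y_times)
qed

lemma mcoeff_coprod_star_Nil_right [simp]: "mcoeff (coprod_star f) (u, []) = mcoeff f u"
proof (induction u arbitrary: f)
  case (Cons m u)
  then show ?case
    using mcoeff_continuous_hom_rec[OF coprod_Y_locally_finite, of "{m}" "(m # u, [])" f]
    by (simp add: coprod_star_eq mcoeff_coprod_Y_times)
qed simp

text \<open>The stuffle recursion read dually: a word in the stuffle product of \<open>m # u\<close>
  and \<open>n # v\<close> starts with \<open>m\<close>, with \<open>n\<close>, or with the merged
  letter \<open>Suc (m + n)\<close>.\<close>

lemma mcoeff_coprod_star_Cons [simp]: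
  "mcoeff (coprod_star f) (m # u, n # v) = mcoeff (coprod_star (quot_left m f)) (u, n # v) +
     mcoeff (coprod_star (quot_left n f)) (m # u, v) +
     mcoeff (coprod_star (quot_left (Suc (m + n)) f)) (u, v)"
  using mcoeff_continuous_hom_rec[OF coprod_Y_locally_finite, of "{..Suc (m + n)}" "(m # u, n # v)" f]
  by (simp add: coprod_star_eq mcoeff_coprod_Y_times sum.distrib del: sum.atMost_Suc)

lemma module_hom_coprod_star: "module_hom mscale mscale coprod_star"
  unfolding coprod_star_eq by (rule module_hom_continuous_hom) (rule coprod_Y_locally_finite)

lemmas coprod_star_linear [simp] =
  module_hom.add[OF module_hom_coprod_star] module_hom.diff[OF module_hom_coprod_star]
  module_hom.neg[OF module_hom_coprod_star]
  module_hom.scale[OF module_hom_coprod_star] module_hom.zero[OF module_hom_coprod_star]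

lemma coprod_star_times: "coprod_star (f * g) = coprod_star f * coprod_star g"
  unfolding coprod_star_eq by (rule continuous_hom_times) (rule coprod_Y_locally_finite)

lemma mcoeff_coprod_star_zero [simp]: "mcoeff (coprod_star f) 0 = mcoeff f []"
  by (simp add: zero_prod_def zero_list_def)

lemma coprod_star_one [simp]: "coprod_star (1 :: 'k :: field_char_0 yseries) = 1"
proof (rule mseries_eqI, clarify)
  fix u v :: "nat list"
  have "quot_left a 1 = (0 :: 'k yseries)" for a
    by (rule mseries_eqI) simp
  then show "mcoeff (coprod_star 1) (u, v) = mcoeff (1 :: 'k yyseries) (u, v)"
    by (cases u; cases v) simp_all
qed

section \<open>Operators on Y-series\<close>

text \<open>Left multiplication by \<open>X0\<close> on \<open>k\<langle>\<langle>X0,X1\<rangle>\<rangle> / k\<langle>\<langle>X0,X1\<rangle>\<rangle>X0\<close>, identified with the Y-series.\<close>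

definition shift :: "'k :: field_char_0 yseries \<Rightarrow> 'k yseries" where
  "shift f = Mseries (\<lambda>w. case w of Suc n # w' \<Rightarrow> mcoeff f (n # w') | _ \<Rightarrow> 0)"

definition shift_fst :: "'k :: field_char_0 yyseries \<Rightarrow> 'k yyseries" where
  "shift_fst F = Mseries (\<lambda>(u, v). mcoeff (shift (fix_snd v F)) u)"

definition shift_snd :: "'k :: field_char_0 yyseries \<Rightarrow> 'k yyseries" where
  "shift_snd F = Mseries (\<lambda>(u, v). mcoeff (shift (fix_fst u F)) v)"

abbreviation y_fst :: "'k :: field_char_0 yyseries" where
  "y_fst \<equiv> mletter 0 \<otimes>\<^sub>m 1"

abbreviation y_snd :: "'k :: field_char_0 yyseries" where
  "y_snd \<equiv> 1 \<otimes>\<^sub>m mletter 0"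

lemma mcoeff_shift [simp]:
  "mcoeff (shift f) [] = 0" "mcoeff (shift f) (0 # w) = 0"
  "mcoeff (shift f) (Suc n # w) = mcoeff f (n # w)"
  by (simp_all add: shift_def)

lemma mcoeff_shift_fst [simp]:
  "mcoeff (shift_fst F) ([], v) = 0" "mcoeff (shift_fst F) (0 # u, v) = 0"
  "mcoeff (shift_fst F) (Suc n # u, v) = mcoeff F (n # u, v)"
  by (simp_all add: shift_fst_def)

lemma mcoeff_shift_snd [simp]:
  "mcoeff (shift_snd F) (u, []) = 0" "mcoeff (shift_snd F) (u, 0 # v) = 0"
  "mcoeff (shift_snd F) (u, Suc n # v) = mcoeff F (u, n # v)"
  by (simp_all add: shift_snd_def)

lemma nat_list_cases: obtains "w = []" | w' where "w = 0 # w'" | n w' where "w = Suc n # w'"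
  by (metis list.exhaust not0_implies_Suc)

lemma yyseries_eqI:
  assumes "\<And>u v. mcoeff F (u, v) = mcoeff G (u, v)"
  shows "F = G"
  using assms by (intro mseries_eqI) auto

lemma module_hom_shift: "module_hom mscale mscale (shift :: 'k :: field_char_0 yseries \<Rightarrow> _)"
proof (standard; rule mseries_eqI)
  fix w
  show "mcoeff (shift (f + g)) w = mcoeff (shift f + shift g) w"
    "mcoeff (shift (mscale c f)) w = mcoeff (mscale c (shift f)) w" for f g :: "'k yseries" and c
    by (cases w rule: nat_list_cases; simp)+
qed

lemma module_hom_shift_fst: "module_hom mscale mscale (shift_fst :: 'k :: field_char_0 yyseries \<Rightarrow> _)"
proof (standard; rule yyseries_eqI)
  fix u v
  show "mcoeff (shift_fst (f + g)) (u, v) = mcoeff (shift_fst f + shift_fst g) (u, v)"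
    "mcoeff (shift_fst (mscale c f)) (u, v) = mcoeff (mscale c (shift_fst f)) (u, v)"
    for f g :: "'k yyseries" and c
    by (cases u rule: nat_list_cases; simp)+
qed

lemma module_hom_shift_snd: "module_hom mscale mscale (shift_snd :: 'k :: field_char_0 yyseries \<Rightarrow> _)"
proof (standard; rule yyseries_eqI)
  fix u v
  show "mcoeff (shift_snd (f + g)) (u, v) = mcoeff (shift_snd f + shift_snd g) (u, v)"
    "mcoeff (shift_snd (mscale c f)) (u, v) = mcoeff (mscale c (shift_snd f)) (u, v)"
    for f g :: "'k yyseries" and c
    by (cases v rule: nat_list_cases; simp)+
qed

lemmas shift_linear [simp] =
  module_hom.add[OF module_hom_shift] module_hom.diff[OF module_hom_shift] module_hom.neg[OF module_hom_shift]
  module_hom.scale[OF module_hom_shift] module_hom.zero[OF module_hom_shift]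
  module_hom.add[OF module_hom_shift_fst] module_hom.diff[OF module_hom_shift_fst] module_hom.neg[OF module_hom_shift_fst]
  module_hom.scale[OF module_hom_shift_fst] module_hom.zero[OF module_hom_shift_fst]
  module_hom.add[OF module_hom_shift_snd] module_hom.diff[OF module_hom_shift_snd] module_hom.neg[OF module_hom_shift_snd]
  module_hom.scale[OF module_hom_shift_snd] module_hom.zero[OF module_hom_shift_snd]

lemma shift_commute:
  "shift_snd (shift_fst F) = shift_fst (shift_snd F)"
  "shift_fst (y_snd * F) = y_snd * shift_fst F"
  "shift_snd (y_fst * F) = y_fst * shift_snd F"
proof -
  show "shift_snd (shift_fst F) = shift_fst (shift_snd F)"
  proof (rule yyseries_eqI)
    show "mcoeff (shift_snd (shift_fst F)) (u, v) = mcoeff (shift_fst (shift_snd F)) (u, v)" for u v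
      by (cases u rule: nat_list_cases; cases v rule: nat_list_cases) simp_all
  qed
  show "shift_fst (y_snd * F) = y_snd * shift_fst F"
  proof (rule yyseries_eqI)
    show "mcoeff (shift_fst (y_snd * F)) (u, v) = mcoeff (y_snd * shift_fst F) (u, v)" for u v
      by (cases u rule: nat_list_cases; cases v) simp_all
  qed
  show "shift_snd (y_fst * F) = y_fst * shift_snd F"
  proof (rule yyseries_eqI)
    show "mcoeff (shift_snd (y_fst * F)) (u, v) = mcoeff (y_fst * shift_snd F) (u, v)" for u v
      by (cases v rule: nat_list_cases; cases u) simp_all
  qed
qed

lemma y_commute: "y_snd * (y_fst * F) = y_fst * (y_snd * F)"
proof -
  have "y_snd * y_fst = y_fst * (y_snd :: 'a yyseries)"
    by (simp add: tensor_times)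
  then show ?thesis by (simp flip: mult.assoc)
qed

lemma quot_left_simps [simp]:
  "quot_left 0 (shift f) = 0" "quot_left (Suc n) (shift f) = quot_left n f"
  "quot_left n (f + g) = quot_left n f + quot_left n g"
  "quot_left n (f - g) = quot_left n f - quot_left n g"
  "quot_left n (mscale c f) = mscale c (quot_left n f)"
  "quot_left n (mletter a * f) = (if n = a then f else 0)"
  "quot_left n 1 = 0"
  by (rule mseries_eqI; simp)+

text \<open>
  In \<open>\<Delta>\<^sub>*(Y\<^sub>n w) = \<Sum> (Y\<^sub>i \<otimes> Y\<^sub>n\<^sub>-\<^sub>i) \<Delta>\<^sub>*(w)\<close>, the summand with \<open>i = n\<close>. It collects the terms
  whose largest summation index belongs to the first factor only.
\<close>

definition coprod_left :: "'k :: field_char_0 yseries \<Rightarrow> 'k yyseries" where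
  "coprod_left f = Mseries (\<lambda>(u, v). case u of [] \<Rightarrow> 0 | n # u' \<Rightarrow> mcoeff (coprod_star (quot_left n f)) (u', v))"

lemma mcoeff_coprod_left [simp]:
  "mcoeff (coprod_left f) ([], v) = 0"
  "mcoeff (coprod_left f) (n # u, v) = mcoeff (coprod_star (quot_left n f)) (u, v)"
  by (simp_all add: coprod_left_def)

lemma module_hom_coprod_left: "module_hom mscale mscale (coprod_left :: 'k :: field_char_0 yseries \<Rightarrow> _)"
proof (standard; rule yyseries_eqI)
  fix u v
  show "mcoeff (coprod_left (f + g)) (u, v) = mcoeff (coprod_left f + coprod_left g) (u, v)"
    "mcoeff (coprod_left (mscale c f)) (u, v) = mcoeff (mscale c (coprod_left f)) (u, v)"
    for f g :: "'k yseries" and c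
    by (cases u; simp)+
qed

lemmas coprod_left_linear [simp] =
  module_hom.add[OF module_hom_coprod_left] module_hom.diff[OF module_hom_coprod_left]
  module_hom.neg[OF module_hom_coprod_left]
  module_hom.scale[OF module_hom_coprod_left] module_hom.zero[OF module_hom_coprod_left]

lemma coprod_left_one [simp]: "coprod_left 1 = 0"
proof (rule yyseries_eqI)
  show "mcoeff (coprod_left 1) (u, v) = mcoeff 0 (u, v)" for u v
    by (cases u) simp_all
qed

lemma coprod_left_shift: "coprod_left (shift f) = shift_fst (coprod_left f)"
proof (rule yyseries_eqI)
  show "mcoeff (coprod_left (shift f)) (u, v) = mcoeff (shift_fst (coprod_left f)) (u, v)" for u v
    by (cases u rule: nat_list_cases) simp_all
qed

lemma coprod_left_y: "coprod_left (mletter 0 * f) = y_fst * coprod_star f"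
proof (rule yyseries_eqI)
  show "mcoeff (coprod_left (mletter 0 * f)) (u, v) = mcoeff (y_fst * coprod_star f) (u, v)" for u v
    by (cases u) simp_all
qed

lemma coprod_star_y: "coprod_star (mletter 0 * f) = y_fst * coprod_star f + y_snd * coprod_star f"
proof (rule yyseries_eqI)
  show "mcoeff (coprod_star (mletter 0 * f)) (u, v) =
      mcoeff (y_fst * coprod_star f + y_snd * coprod_star f) (u, v)" for u v
    by (cases u; cases v) simp_all
qed

text \<open>For f = Y_n w, compare the summands of \<Delta>(Y_(n+1)) and \<Delta>(Y_n). The summand
  Y_(n+1) \<otimes> 1 is a shift of Y_n \<otimes> 1, those with first index below n come from
  raising the second factor, and the remaining Y_n \<otimes> Y_1 gives the last term.\<close>

lemma coprod_star_shift:
  "coprod_star (shift f) = shift_fst (coprod_left f) + shift_snd (coprod_star f - coprod_left f) +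
     y_snd * coprod_left f"
proof (rule yyseries_eqI)
  show "mcoeff (coprod_star (shift f)) (u, v) =
      mcoeff (shift_fst (coprod_left f) + shift_snd (coprod_star f - coprod_left f) +
        y_snd * coprod_left f) (u, v)" for u v
    by (cases u rule: nat_list_cases; cases v rule: nat_list_cases) (simp_all split: nat.split)
qed

section \<open>Weights\<close>

abbreviation weight :: "nat list \<Rightarrow> nat" where
  "weight w \<equiv> sum_list (map Suc w)"

definition low :: "nat \<Rightarrow> 'k :: field_char_0 yseries set" where
  "low n = {f. \<forall>w. weight w < n \<longrightarrow> mcoeff f w = 0}"

definition low2 :: "nat \<Rightarrow> 'k :: field_char_0 yyseries set" where
  "low2 n = {F. \<forall>u v. weight u + weight v < n \<longrightarrow> mcoeff F (u, v) = 0}"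

lemma low_simps [simp, intro]:
  "0 \<in> low n" "f \<in> low n \<Longrightarrow> g \<in> low n \<Longrightarrow> f + g \<in> low n" "f \<in> low n \<Longrightarrow> g \<in> low n \<Longrightarrow> f - g \<in> low n"
  "f \<in> low n \<Longrightarrow> - f \<in> low n" "f \<in> low n \<Longrightarrow> mscale c f \<in> low n"
  "f \<in> low 0"
  by (auto simp: low_def)

lemma low2_simps [simp, intro]:
  "0 \<in> low2 n" "f \<in> low2 n \<Longrightarrow> g \<in> low2 n \<Longrightarrow> f + g \<in> low2 n" "f \<in> low2 n \<Longrightarrow> g \<in> low2 n \<Longrightarrow> f - g \<in> low2 n"
  "f \<in> low2 n \<Longrightarrow> - f \<in> low2 n" "f \<in> low2 n \<Longrightarrow> mscale c f \<in> low2 n"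
  "f \<in> low2 0"
  by (auto simp: low2_def)

lemma low_SucD: "f \<in> low (Suc n) \<Longrightarrow> f \<in> low n" "F \<in> low2 (Suc n) \<Longrightarrow> F \<in> low2 n"
  by (auto simp: low_def low2_def)

text \<open>Each case of the stuffle recursion preserves the total weight, including the merging of
  two letters.\<close>

lemma coprod_star_weight:
  assumes "\<And>w. weight w = weight u + weight v \<Longrightarrow> mcoeff f w = 0"
  shows "mcoeff (coprod_star f) (u, v) = 0"
  using assms
proof (induction "length u + length v" arbitrary: u v f rule: less_induct)
  case less
  show ?case
  proof (cases "u = [] \<or> v = []")
    case True
    then show ?thesis using less.prems by auto
  next
    case False
    then obtain m u' n v' where [simp]: "u = m # u'" "v = n # v'"
      by (metis list.exhaust)
    have "mcoeff (coprod_star (quot_left m f)) (u', v) = 0"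
      "mcoeff (coprod_star (quot_left n f)) (u, v') = 0"
      "mcoeff (coprod_star (quot_left (Suc (m + n)) f)) (u', v') = 0"
      by (rule less.hyps; use less.prems in simp)+
    then show ?thesis by simp
  qed
qed

lemma low_coprod_star: "f \<in> low n \<Longrightarrow> coprod_star f \<in> low2 n"
  by (auto simp: low_def low2_def intro!: coprod_star_weight)

lemma low_coprod_left:
  assumes "f \<in> low n"
  shows "coprod_left f \<in> low2 n"
proof -
  have "mcoeff (coprod_left f) (u, v) = 0" if "weight u + weight v < n" for u v
    using assms that by (cases u) (auto simp: low_def intro!: coprod_star_weight)
  then show ?thesis by (simp add: low2_def)
qed

lemma low_Suc:
  "f \<in> low n \<Longrightarrow> shift f \<in> low (Suc n)" "f \<in> low n \<Longrightarrow> mletter 0 * f \<in> low (Suc n)"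
proof -
  assume f: "f \<in> low n"
  have "mcoeff (shift f) w = 0 \<and> mcoeff (mletter 0 * f) w = 0" if "weight w < Suc n" for w
    using f that by (cases w rule: nat_list_cases) (auto simp: low_def)
  then show "shift f \<in> low (Suc n)" "mletter 0 * f \<in> low (Suc n)"
    by (simp_all add: low_def)
qed

lemma low2_Suc:
  "F \<in> low2 n \<Longrightarrow> shift_fst F \<in> low2 (Suc n)" "F \<in> low2 n \<Longrightarrow> shift_snd F \<in> low2 (Suc n)"
  "F \<in> low2 n \<Longrightarrow> y_fst * F \<in> low2 (Suc n)" "F \<in> low2 n \<Longrightarrow> y_snd * F \<in> low2 (Suc n)"
proof -
  assume f: "F \<in> low2 n"
  have "mcoeff (shift_fst F) (u, v) = 0 \<and> mcoeff (shift_snd F) (u, v) = 0 \<and>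
      mcoeff (y_fst * F) (u, v) = 0 \<and> mcoeff (y_snd * F) (u, v) = 0" if "weight u + weight v < Suc n" for u v
    using f that by (cases u rule: nat_list_cases; cases v rule: nat_list_cases) (auto simp: low2_def)
  then show "shift_fst F \<in> low2 (Suc n)" "shift_snd F \<in> low2 (Suc n)"
    "y_fst * F \<in> low2 (Suc n)" "y_snd * F \<in> low2 (Suc n)"
    by (simp_all add: low2_def)
qed

section \<open>A representation of the braid Lie algebra\<close>

text \<open>The first component carries the range m > n of the double series, the second the
  one-variable series in xy.\<close>

type_synonym 'k braid_module = "'k yyseries \<times> 'k yseries"

definition bscale :: "'k :: field_char_0 \<Rightarrow> 'k braid_module \<Rightarrow> 'k braid_module" where
  "bscale c x = (mscale c (fst x), mscale c (snd x))"

lemma bscale_Pair [simp]: "bscale c (F, f) = (mscale c F, mscale c f)"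
  by (simp add: bscale_def)

interpretation bmod: word_module bscale
  by standard (simp_all add: bscale_def algebra_simps)

definition op_12 :: "'k :: field_char_0 braid_module \<Rightarrow> 'k braid_module" where
  "op_12 = (\<lambda>(F, f). (shift_snd F - y_snd * coprod_left f, shift f))"

definition op_23 :: "'k :: field_char_0 braid_module \<Rightarrow> 'k braid_module" where
  "op_23 = (\<lambda>(F, f). (- (y_snd * (F - coprod_left f)), 0))"

definition op_24 :: "'k :: field_char_0 braid_module \<Rightarrow> 'k braid_module" where
  "op_24 = (\<lambda>(F, f). (0, - (mletter 0 * f)))"

definition op_34 :: "'k :: field_char_0 braid_module \<Rightarrow> 'k braid_module" where
  "op_34 = (\<lambda>(F, f). (- (y_fst * (F + coprod_star f - coprod_left f)), 0))"

definition op_123 :: "'k :: field_char_0 braid_module \<Rightarrow> 'k braid_module" where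
  "op_123 = (\<lambda>(F, f). (shift_fst F, shift f))"

lemmas op_defs = op_12_def op_23_def op_24_def op_34_def op_123_def

lemma op_simps [simp]:
  "op_12 (F, f) = (shift_snd F - y_snd * coprod_left f, shift f)"
  "op_23 (F, f) = (- (y_snd * (F - coprod_left f)), 0)"
  "op_24 (F, f) = (0, - (mletter 0 * f))"
  "op_34 (F, f) = (- (y_fst * (F + coprod_star f - coprod_left f)), 0)"
  "op_123 (F, f) = (shift_fst F, shift f)"
  by (simp_all add: op_defs)

text \<open>
  The operators are the residues along \<open>y = 0\<close>, \<open>y = 1\<close>, \<open>xy = 1\<close>, \<open>x = 1\<close> and \<open>x = 0\<close> of the
  differential equation of the part \<open>m > n\<close> of the double generating function. The residue
  \<open>op_123\<close> is the action of \<open>t\<^sub>1\<^sub>2 + t\<^sub>1\<^sub>3 + t\<^sub>2\<^sub>3\<close>, and the central element \<open>\<Sum>\<^bsub>i<j\<^esub> t\<^sub>i\<^sub>j\<close> acts as \<open>0\<close>.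
\<close>

fun braid_op :: "strand \<times> strand \<Rightarrow> 'k :: field_char_0 braid_module \<Rightarrow> 'k braid_module" where
  "braid_op (S1, S2) x = op_12 x"
| "braid_op (S2, S1) x = op_12 x"
| "braid_op (S2, S3) x = op_23 x"
| "braid_op (S3, S2) x = op_23 x"
| "braid_op (S2, S4) x = op_24 x"
| "braid_op (S4, S2) x = op_24 x"
| "braid_op (S3, S4) x = op_34 x"
| "braid_op (S4, S3) x = op_34 x"
| "braid_op (S1, S3) x = op_123 x - op_12 x - op_23 x"
| "braid_op (S3, S1) x = op_123 x - op_12 x - op_23 x"
| "braid_op (S1, S4) x = - (op_123 x + op_34 x + op_24 x)"
| "braid_op (S4, S1) x = - (op_123 x + op_34 x + op_24 x)"
| "braid_op _ x = 0"

lemma op_hom: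
  "module_hom bscale bscale op_12" "module_hom bscale bscale op_23" "module_hom bscale bscale op_24"
  "module_hom bscale bscale op_34" "module_hom bscale bscale op_123"
  by (standard; clarsimp simp: algebra_simps mseries.scale_right_diff_distrib)+

lemma braid_op_hom: "module_hom bscale bscale (braid_op g)"
proof -
  note op_linear = op_hom[THEN module_hom.add] op_hom[THEN module_hom.scale]
  obtain i j where [simp]: "g = (i, j)" by force
  show ?thesis
    by standard (cases i; cases j; simp add: op_linear bmod.scale_right_diff_distrib bmod.scale_right_distrib)+
qed

interpretation braid: generator_action bscale braid_op
  by (intro generator_action.intro generator_action_axioms.intro bmod.word_module_axioms braid_op_hom)

lemma lie_act_tgen [simp]: "braid.lie_act (tgen i j) x = braid_op (i, j) x"
  by (simp add: tgen_def)

text \<open>The commutators from which all braid relations follow, directed as rewrite rules for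
  products of two operators. They reduce to the behaviour of \<open>coprod_star\<close> and
  \<open>coprod_left\<close> under \<open>shift\<close> and under multiplication by Y_1.\<close>

lemma op_commute:
  "op_12 (op_123 x) = op_123 (op_12 x)"
  "op_23 (op_123 x) = op_123 (op_23 x)"
  "op_34 (op_12 x) = op_12 (op_34 x)"
  "op_24 (op_23 x) = op_23 (op_24 x) + op_23 (op_34 x) - op_34 (op_23 x)"
  "op_34 (op_24 x) = op_24 (op_34 x) + op_23 (op_34 x) - op_34 (op_23 x)"
  "op_24 (op_123 x) = op_123 (op_24 x) + op_24 (op_12 x) - op_12 (op_24 x)
      + op_34 (op_24 x) - op_24 (op_34 x)"
proof -
  obtain F f where [simp]: "x = (F, f)" by force
  note rules = shift_commute y_commute coprod_left_shift coprod_left_y coprod_star_y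
      coprod_star_shift
  show "op_12 (op_123 x) = op_123 (op_12 x)"
    by (simp add: rules)
  show "op_23 (op_123 x) = op_123 (op_23 x)"
    by (simp add: rules)
  show "op_34 (op_12 x) = op_12 (op_34 x)"
    by (simp add: rules ring_distribs)
  show  "op_24 (op_23 x) = op_23 (op_24 x) + op_23 (op_34 x) - op_34 (op_23 x)"
    by (simp add: rules ring_distribs zero_prod_def)
  show "op_34 (op_24 x) = op_24 (op_34 x) + op_23 (op_34 x) - op_34 (op_23 x)"
    by (simp add: rules ring_distribs)
  show "op_24 (op_123 x) = op_123 (op_24 x) + op_24 (op_12 x) - op_12 (op_24 x)
      + op_34 (op_24 x) - op_24 (op_34 x)"
    by (simp add: rules ring_distribs)
qed


lemma braid_op_relations: "r \<in> braid_relations \<Longrightarrow> braid.lie_act r x = 0"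
proof (induction rule: braid_relations.induct)
  case (1 i)
  show ?case by (cases i) simp_all
next
  case (2 i j)
  show ?case by (cases i; cases j) simp_all
next
  case (3 i j k)
  note op_linear = op_hom[THEN module_hom.add] op_hom[THEN module_hom.diff] op_hom[THEN module_hom.neg]
  from 3 show ?case
    by (cases i; cases j; cases k) (simp_all add: op_linear op_commute algebra_simps)
next
  case (4 i j k l)
  note op_linear = op_hom[THEN module_hom.add] op_hom[THEN module_hom.diff] op_hom[THEN module_hom.neg]
  from 4 show ?case
    by (cases i; cases j; cases k; cases l) (simp_all add: op_linear op_commute algebra_simps)
qed

definition braid_fil :: "nat \<Rightarrow> 'k :: field_char_0 braid_module set" where
  "braid_fil n = low2 n \<times> low n"

lemma op_braid_fil:
  assumes "x \<in> braid_fil n"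
  shows "op_12 x \<in> braid_fil (Suc n)" "op_23 x \<in> braid_fil (Suc n)" "op_24 x \<in> braid_fil (Suc n)"
    "op_34 x \<in> braid_fil (Suc n)" "op_123 x \<in> braid_fil (Suc n)"
  using assms
  by (cases x; auto simp: braid_fil_def intro!: low_Suc low2_Suc low_coprod_left low_coprod_star low_simps low2_simps)+

lemma braid_fil_simps:
  "0 \<in> braid_fil n" "x \<in> braid_fil n \<Longrightarrow> y \<in> braid_fil n \<Longrightarrow> x + y \<in> braid_fil n"
  "x \<in> braid_fil n \<Longrightarrow> y \<in> braid_fil n \<Longrightarrow> x - y \<in> braid_fil n" "x \<in> braid_fil n \<Longrightarrow> - x \<in> braid_fil n"
  "x \<in> braid_fil n \<Longrightarrow> bscale c x \<in> braid_fil n" "x \<in> braid_fil (Suc n) \<Longrightarrow> x \<in> braid_fil n"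
  "braid_fil 0 = UNIV"
  by (auto simp: braid_fil_def zero_prod_def bscale_def dest: low_SucD)

lemma braid_op_fil:
  assumes "x \<in> braid_fil n"
  shows "braid_op g x \<in> braid_fil (Suc n)"
proof -
  obtain i j where [simp]: "g = (i, j)" by force
  show ?thesis
    by (cases i; cases j) (simp_all add: op_braid_fil[OF assms] braid_fil_simps(1-4))
qed

text \<open>Every nonempty word kills \<open>v\<close>. This disposes of the factor \<phi>(t12, t23)
  when the pentagon equation is applied to (0, 1).\<close>

lemma (in word_module) xseries_act_fixed:
  assumes "P v = 0" "Q v = 0" "P 0 = 0" "Q 0 = 0" "n > 0"
  shows "xseries_act \<phi> n P Q v = mcoeff \<phi> [] *s v"
proof -
  have zero: "xword_act P Q W v = (if W = [] then v else 0)" for W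
  proof (induction W)
    case (Cons a W)
    then show ?case using assms by (cases a) auto
  qed simp
  have "xseries_act \<phi> n P Q v = (\<Sum>W\<in>{[]}. mcoeff \<phi> W *s xword_act P Q W v)"
    unfolding xseries_act_def
    by (rule sum.mono_neutral_right) (use assms finite_xwords in \<open>auto simp: zero\<close>)
  then show ?thesis by simp
qed

section \<open>The map \<open>\<pi>\<^sub>Y\<close> expressed through operators on Y-series\<close>

abbreviation \<pi>\<^sub>Y_trunc :: "(xletter list, 'k :: field_char_0) mseries \<Rightarrow> nat \<Rightarrow> 'k yseries" where
  "\<pi>\<^sub>Y_trunc \<phi> n \<equiv> mseries.xseries_act \<phi> n shift (\<lambda>f. - (mletter 0 * f)) 1"

lemma length_x_word: "length (x_word ns) = weight ns"
  by (induction ns) (simp_all add: x_word_def)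

lemma x_word_simps [simp]:
  "x_word [] = []" "x_word (0 # ns) = X1 # x_word ns" "x_word (Suc n # ns) = X0 # x_word (n # ns)"
  by (simp_all add: x_word_def)

text \<open>Modulo series ending in X0, left multiplication by X0 and X1 becomes
  \<open>shift\<close> and multiplication by - Y_1. Applied to 1, a word therefore yields its image
  under \<open>\<pi>\<^sub>Y\<close>.\<close>

lemma mcoeff_xword_act_shift:
  "mcoeff (mseries.xword_act shift (\<lambda>f. - (mletter 0 * f)) W (1 :: 'k :: field_char_0 yseries)) ns =
     (if W = x_word ns then (- 1) ^ length ns else 0)"
proof (induction W arbitrary: ns)
  case Nil
  show ?case by (cases ns rule: nat_list_cases) simp_all
next
  case (Cons a W)
  then show ?case
    by (cases a; cases ns rule: nat_list_cases) simp_all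
qed

lemma mcoeff_\<pi>\<^sub>Y_trunc: "weight ns < n \<Longrightarrow> mcoeff (\<pi>\<^sub>Y_trunc \<phi> n) ns = mcoeff (\<pi>\<^sub>Y \<phi>) ns"
proof -
  assume n: "weight ns < n"
  have "mcoeff (\<pi>\<^sub>Y_trunc \<phi> n) ns =
      (\<Sum>W | length W < n. if W = x_word ns then mcoeff \<phi> W * (- 1) ^ length ns else 0)"
    unfolding mseries.xseries_act_def mcoeff_sum mcoeff_mscale mcoeff_xword_act_shift
    by (intro sum.cong) auto
  also have "\<dots> = mcoeff \<phi> (x_word ns) * (- 1) ^ length ns"
    using n by (subst sum.delta[OF finite_xwords]) (auto simp: length_x_word)
  finally show ?thesis by (simp add: \<pi>\<^sub>Y_def)
qed

text \<open>
  The abelianization of the part of \<open>\<phi>\<close> that does not end in \<open>X0\<close>, with the images of \<open>X0\<close> and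
  \<open>X1\<close> those along the exceptional divisor over \<open>(1, 1)\<close>.
\<close>

definition abel_letter :: "xletter \<Rightarrow> 'k :: field_char_0 yyseries" where
  "abel_letter a = (case a of X0 \<Rightarrow> - y_snd | X1 \<Rightarrow> - y_fst)"

definition drop_X0 :: "(xletter list, 'k :: field_char_0) mseries \<Rightarrow> (xletter list, 'k) mseries" where
  "drop_X0 \<phi> = Mseries (\<lambda>W. if W \<noteq> [] \<and> last W = X0 then 0 else mcoeff \<phi> W)"

definition abel_factor :: "(xletter list, 'k :: field_char_0) mseries \<Rightarrow> 'k yyseries" where
  "abel_factor \<phi> = continuous_hom abel_letter (drop_X0 \<phi>)"

text \<open>The images of the letters commute, so a word with p letters X1 and q letters X0 becomes
  (-1)^(p+q) Y_1^p \<otimes> Y_1^q.\<close>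

lemma mcoeff_abel_word:
  "mcoeff (prod_list (map abel_letter W)) (u, v) =
     (if u = replicate (count_list W X1) 0 \<and> v = replicate (count_list W X0) 0 then (- 1) ^ length W else 0)"
proof (induction W arbitrary: u v)
  case Nil
  then show ?case by simp
next
  case (Cons a W)
  show ?case
  proof (cases a)
    case X0
    with Cons show ?thesis by (cases v) (auto simp: abel_letter_def)
  next
    case X1
    with Cons show ?thesis by (cases u) (auto simp: abel_letter_def)
  qed
qed

lemma length_xword: "length W = count_list W X0 + count_list W X1"
  by (induction W) (auto, metis xletter.exhaust)

lemma abel_support:
  "mcoeff (prod_list (map abel_letter W)) (u, v) \<noteq> 0 \<Longrightarrow> length W = length u + length v"
  by (auto simp: mcoeff_abel_word length_xword split: if_splits)

lemma abel_letter_locally_finite: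
  "finite {W. mcoeff (prod_list (map (abel_letter :: _ \<Rightarrow> 'k :: field_char_0 yyseries) W)) m \<noteq> 0}"
  by (rule finite_subset[OF _ finite_xwords[of "Suc (length (fst m) + length (snd m))"]])
    (cases m; auto dest: abel_support)

lemma mcoeff_abel_factor:
  assumes "length u + length v < n"
  shows "mcoeff (abel_factor \<phi>) (u, v) =
    (\<Sum>W | length W < n. mcoeff (drop_X0 \<phi>) W * mcoeff (prod_list (map abel_letter W)) (u, v))"
  unfolding abel_factor_def
  by (rule mcoeff_continuous_hom[OF abel_letter_locally_finite finite_xwords])
    (use assms in \<open>auto dest: abel_support\<close>)

lemma xword_act_abel:
  "mseries.xword_act (\<lambda>F. - (y_snd * F)) (\<lambda>F. - (y_fst * F)) W F = prod_list (map abel_letter W) * F"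
proof (induction W)
  case (Cons a W)
  then show ?case by (cases a) (simp_all add: abel_letter_def mult.assoc)
qed simp

text \<open>
  The range \<open>m > n\<close> contributes \<open>F\<close>, and along the path through \<open>y = 0\<close> and \<open>x = 1\<close> the ranges
  \<open>m = n\<close> and \<open>m < n\<close> together contribute \<open>coprod_star f - coprod_left f\<close>.
\<close>

definition total :: "'k :: field_char_0 braid_module \<Rightarrow> 'k yyseries" where
  "total = (\<lambda>(F, f). F + coprod_star f - coprod_left f)"

lemma total_Pair [simp]: "total (F, f) = F + coprod_star f - coprod_left f"
  by (simp add: total_def)

lemma module_hom_total: "module_hom bscale mscale total"
  by standard (clarsimp simp: algebra_simps mseries.scale_right_diff_distrib)+

text \<open>On these vectors \<open>op_23\<close> vanishes and \<open>total\<close> gives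
  \<open>coprod_star f\<close>; the starting vector (0, 1) is \<open>graph 1\<close>.\<close>

definition graph :: "'k :: field_char_0 yseries \<Rightarrow> 'k braid_module" where
  "graph f = (coprod_left f, f)"

lemma module_hom_graph: "module_hom mscale bscale graph"
  by standard (simp_all add: graph_def)

section \<open>Both sides of the pentagon equation applied to (0, 1)\<close>

lemma shift_one [simp]:
  "shift 1 = (0 :: 'k :: field_char_0 yseries)"
  "shift_fst 1 = (0 :: 'k yyseries)" "shift_snd 1 = (0 :: 'k yyseries)"
proof -
  show "shift 1 = (0 :: 'k yseries)"
  proof (rule mseries_eqI)
    show "mcoeff (shift 1) w = mcoeff (0 :: 'k yseries) w" for w
      by (cases w rule: nat_list_cases) simp_all
  qed
  show "shift_fst 1 = (0 :: 'k yyseries)"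
  proof (rule yyseries_eqI)
    show "mcoeff (shift_fst 1) (u, v) = mcoeff (0 :: 'k yyseries) (u, v)" for u v
      by (cases u rule: nat_list_cases) simp_all
  qed
  show "shift_snd 1 = (0 :: 'k yyseries)"
  proof (rule yyseries_eqI)
    show "mcoeff (shift_snd 1) (u, v) = mcoeff (0 :: 'k yyseries) (u, v)" for u v
      by (cases v rule: nat_list_cases) simp_all
  qed
qed

text \<open>Seen through \<open>total\<close>, the factor acting first works on the first tensor
  variable and turns 1 \<otimes> 1 into s \<otimes> 1; the other works on the second variable and
  yields s \<otimes> s.\<close>

lemma total_first_path:
  "total (bmod.xseries_act \<phi> n op_12 (\<lambda>x. op_23 x + op_24 x)
     (bmod.xseries_act \<phi> n (\<lambda>x. op_123 x - op_12 x) op_34 (0, 1))) = \<pi>\<^sub>Y_trunc \<phi> n \<otimes>\<^sub>m \<pi>\<^sub>Y_trunc \<phi> n"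
proof -
  let ?s = "\<pi>\<^sub>Y_trunc \<phi> n"
  let ?x = "bmod.xseries_act \<phi> n (\<lambda>x. op_123 x - op_12 x) op_34 (0, 1)"
  have "total ?x = mseries.xseries_act \<phi> n (\<lambda>F. shift_fst F - shift_snd F) (\<lambda>F. - (y_fst * F)) (total (0, 1))"
  \<comment> \<open>If the second component is a constant, \<open>coprod_left\<close> vanishes on it
    and the shifts kill its coproduct. This makes \<open>total\<close> compatible with
    \<open>op_123 - op_12\<close>.\<close>
  proof (rule xseries_act_intertwine[OF module_hom_total, where S = "\<lambda>x. \<exists>c. snd x = mscale c 1"])
    show "\<exists>c. snd (0 :: 'a yyseries, 1 :: 'a yseries) = mscale c 1"
      by (intro exI[of _ 1]) simp
  next
    fix x :: "'a braid_module" assume "\<exists>c. snd x = mscale c 1"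
    then obtain F c where [simp]: "x = (F, mscale c 1)"
      by (metis prod.collapse)
    show "(\<exists>c. snd (op_123 x - op_12 x) = mscale c 1) \<and>
        total (op_123 x - op_12 x) = shift_fst (total x) - shift_snd (total x)"
      by (auto intro: exI[of _ 0])
    show "(\<exists>c. snd (op_34 x) = mscale c 1) \<and> total (op_34 x) = - (y_fst * total x)"
      by (auto intro: exI[of _ 0])
  qed
  also have "total (0, 1) = 1 \<otimes>\<^sub>m 1"
    by simp
  \<comment> \<open>On series f \<otimes> 1 the operator \<open>shift_snd\<close> vanishes.\<close>
  also have "mseries.xseries_act \<phi> n (\<lambda>F. shift_fst F - shift_snd F) (\<lambda>F. - (y_fst * F)) (1 \<otimes>\<^sub>m 1) = ?s \<otimes>\<^sub>m 1"
  proof (rule xseries_act_intertwine[symmetric, where S = "\<lambda>_. True" and f = "\<lambda>f. f \<otimes>\<^sub>m 1"])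
    show "module_hom mscale mscale (\<lambda>f :: 'a yseries. f \<otimes>\<^sub>m 1 :: 'a yyseries)"
      by standard (auto intro!: yyseries_eqI simp: algebra_simps)
    show "True \<and> shift f \<otimes>\<^sub>m 1 = shift_fst (f \<otimes>\<^sub>m 1) - shift_snd (f \<otimes>\<^sub>m 1)" for f :: "'a yseries"
    proof (intro conjI TrueI yyseries_eqI)
      show "mcoeff (shift f \<otimes>\<^sub>m 1) (u, v) = mcoeff (shift_fst (f \<otimes>\<^sub>m 1) - shift_snd (f \<otimes>\<^sub>m 1)) (u, v)" for u v :: "nat list"
        by (cases u rule: nat_list_cases; cases v rule: nat_list_cases) simp_all
    qed
    show "True \<and> - (mletter 0 * f) \<otimes>\<^sub>m 1 = - (y_fst * f \<otimes>\<^sub>m 1)" for f :: "'a yseries"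
      by (auto simp: tensor_times intro!: yyseries_eqI)
  qed simp
  finally have x: "total ?x = ?s \<otimes>\<^sub>m 1" .
  \<comment> \<open>Here \<open>total\<close> intertwines on the whole module: the correction term
    in \<open>op_12\<close> cancels the last term of \<open>coprod_star_shift\<close>.\<close>
  have "total (bmod.xseries_act \<phi> n op_12 (\<lambda>x. op_23 x + op_24 x) ?x) =
      mseries.xseries_act \<phi> n shift_snd (\<lambda>F. - (y_snd * F)) (total ?x)"
    by (rule xseries_act_intertwine[OF module_hom_total, where S = "\<lambda>_. True"])
      (auto simp: coprod_star_y coprod_star_shift coprod_left_y coprod_left_shift algebra_simps)
  also have "\<dots> = mseries.xseries_act \<phi> n shift_snd (\<lambda>F. - (y_snd * F)) (?s \<otimes>\<^sub>m 1)"
    by (simp only: x)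
  also have "\<dots> = ?s \<otimes>\<^sub>m ?s"
  proof (rule xseries_act_intertwine[symmetric, where S = "\<lambda>_. True" and f = "\<lambda>f. ?s \<otimes>\<^sub>m f"])
    show "module_hom mscale mscale (\<lambda>f :: 'a yseries. ?s \<otimes>\<^sub>m f :: 'a yyseries)"
      by standard (auto intro!: yyseries_eqI simp: algebra_simps)
    show "True \<and> ?s \<otimes>\<^sub>m shift f = shift_snd (?s \<otimes>\<^sub>m f)" for f :: "'a yseries"
    proof (intro conjI TrueI yyseries_eqI)
      show "mcoeff (?s \<otimes>\<^sub>m shift f) (u, v) = mcoeff (shift_snd (?s \<otimes>\<^sub>m f)) (u, v)" for u v :: "nat list"
        by (cases v rule: nat_list_cases) simp_all
    qed
    show "True \<and> ?s \<otimes>\<^sub>m (- (mletter 0 * f)) = - (y_snd * ?s \<otimes>\<^sub>m f)" for f :: "'a yseries"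
      by (auto simp: tensor_times intro!: yyseries_eqI)
  qed simp
  finally show ?thesis .
qed

text \<open>The last letter of a word acts first. If it is X0, the vector is killed by
  \<open>op_23\<close>; if it is X1, the second component becomes 0, and on vectors (F, 0) both
  operators are mere multiplications.\<close>

lemma total_exceptional:
  "total (bmod.xseries_act \<phi> n op_23 op_34 (graph f)) =
     mseries.xseries_act (drop_X0 \<phi>) n (\<lambda>F. - (y_snd * F)) (\<lambda>F. - (y_fst * F)) (coprod_star f)"
proof -
  interpret total: module_hom bscale mscale total by (rule module_hom_total)
  let ?a = "bmod.xword_act op_23 op_34" and ?b = "mseries.xword_act (\<lambda>F. - (y_snd * F)) (\<lambda>F. - (y_fst * F))"
  have pair: "?a W (F, 0) = (?b W F, 0)" for W and F :: "'a yyseries"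
  proof (induction W)
    case (Cons a W)
    then show ?case by (cases a) simp_all
  qed simp
  have "mscale (mcoeff \<phi> W) (total (?a W (graph f))) = mscale (mcoeff (drop_X0 \<phi>) W) (?b W (coprod_star f))" for W
  proof (cases W rule: rev_cases)
    case Nil
    then show ?thesis by (simp add: graph_def drop_X0_def)
  next
    case (snoc V a)
    show ?thesis
    proof (cases a)
      case X0
      have "?a V 0 = (0 :: 'a braid_module)"
        using pair[of V 0] by (simp add: xword_act_abel zero_prod_def)
      with X0 snoc show ?thesis by (simp add: graph_def drop_X0_def flip: zero_prod_def)
    next
      case X1
      with snoc show ?thesis by (simp add: graph_def drop_X0_def pair)
    qed
  qed
  then show ?thesis
    by (simp add: bmod.xseries_act_def mseries.xseries_act_def total.sum total.scale)
qed

text \<open>Both operators preserve the vectors \<open>graph f\<close> and act on \<open>f\<close>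
  as X0 and X1 do in \<open>\<pi>\<^sub>Y\<close>.\<close>

lemma graph_second_path:
  "bmod.xseries_act \<phi> n (\<lambda>x. op_123 x - op_23 x) (\<lambda>x. op_24 x + op_34 x) (0, 1) = graph (\<pi>\<^sub>Y_trunc \<phi> n)"
proof -
  have "bmod.xseries_act \<phi> n (\<lambda>x. op_123 x - op_23 x) (\<lambda>x. op_24 x + op_34 x) (graph 1) =
      graph (\<pi>\<^sub>Y_trunc \<phi> n)"
    by (rule xseries_act_intertwine[OF module_hom_graph, where S = "\<lambda>_. True", symmetric])
      (auto simp: graph_def coprod_left_shift coprod_left_y)
  then show ?thesis by (simp add: graph_def)
qed

lemma mcoeff_coprod_star_cong:
  assumes "\<And>w. weight w < n \<Longrightarrow> mcoeff f w = mcoeff g w" "weight u + weight v < n"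
  shows "mcoeff (coprod_star f) (u, v) = mcoeff (coprod_star g) (u, v)"
  using coprod_star_weight[of u v "f - g"] assms by simp

lemma pentagon_imp_abel_factor:
  fixes \<phi> :: "(xletter list, 'k :: field_char_0) mseries"
  assumes const: "mcoeff \<phi> [] = 1" and "pentagon \<phi>"
  shows "\<pi>\<^sub>Y \<phi> \<otimes>\<^sub>m \<pi>\<^sub>Y \<phi> = abel_factor \<phi> * coprod_star (\<pi>\<^sub>Y \<phi>)"
proof (rule yyseries_eqI)
  fix u v
  \<comment> \<open>This level lies just above the weight of (u, v), so neither
    \<open>low2 n\<close> nor the truncations affect the coefficient there.\<close>
  define n where "n = Suc (weight u + weight v)"
  let ?s = "\<pi>\<^sub>Y_trunc \<phi> n"
  let ?v0 = "(0, 1) :: 'k braid_module"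
  have "subst \<phi> (tgen S1 S2) (tgen S2 S3 + tgen S2 S4) n * subst \<phi> (tgen S1 S3 + tgen S2 S3) (tgen S3 S4) n -
      subst \<phi> (tgen S2 S3) (tgen S3 S4) n * subst \<phi> (tgen S1 S2 + tgen S1 S3) (tgen S2 S4 + tgen S3 S4) n
       * subst \<phi> (tgen S1 S2) (tgen S2 S3) n \<in> env_filtration braid_relations n"
    using \<open>pentagon \<phi>\<close> unfolding pentagon_def env_completed_eq_def env_completed_times_def by blast
  note braid.env_act_filtration[OF braid_op_relations braid_fil_simps(1,2,5,7,6) braid_op_fil this, of ?v0]
  moreover have "braid.lie_act (tgen S1 S2) = (op_12 :: 'k braid_module \<Rightarrow> _)" "braid.lie_act (tgen S2 S3) = (op_23 :: 'k braid_module \<Rightarrow> _)"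
    "braid.lie_act (tgen S3 S4) = (op_34 :: 'k braid_module \<Rightarrow> _)"
    "braid.lie_act (tgen S2 S3 + tgen S2 S4) = (\<lambda>x :: 'k braid_module. op_23 x + op_24 x)"
    "braid.lie_act (tgen S1 S3 + tgen S2 S3) = (\<lambda>x :: 'k braid_module. op_123 x - op_12 x)"
    "braid.lie_act (tgen S1 S2 + tgen S1 S3) = (\<lambda>x :: 'k braid_module. op_123 x - op_23 x)"
    "braid.lie_act (tgen S2 S4 + tgen S3 S4) = (\<lambda>x :: 'k braid_module. op_24 x + op_34 x)"
    by (auto simp: fun_eq_iff)
  moreover have "bmod.xseries_act \<phi> n op_12 op_23 ?v0 = ?v0"
    by (subst bmod.xseries_act_fixed) (simp_all add: n_def zero_prod_def const)
  ultimately have "bmod.xseries_act \<phi> n op_12 (\<lambda>x. op_23 x + op_24 x)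
     (bmod.xseries_act \<phi> n (\<lambda>x. op_123 x - op_12 x) op_34 ?v0) -
     bmod.xseries_act \<phi> n op_23 op_34 (graph ?s) \<in> braid_fil n"
    by (simp add: braid.env_act_subst graph_second_path)
  then have "total (bmod.xseries_act \<phi> n op_12 (\<lambda>x. op_23 x + op_24 x)
     (bmod.xseries_act \<phi> n (\<lambda>x. op_123 x - op_12 x) op_34 ?v0) -
     bmod.xseries_act \<phi> n op_23 op_34 (graph ?s)) \<in> low2 n"
    unfolding total_def braid_fil_def
    by (auto intro!: low_coprod_left low_coprod_star low2_simps simp: add_diff_eq[symmetric])
  then have "?s \<otimes>\<^sub>m ?s - mseries.xseries_act (drop_X0 \<phi>) n (\<lambda>F. - (y_snd * F)) (\<lambda>F. - (y_fst * F)) (coprod_star ?s) \<in> low2 n"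
    by (simp add: module_hom.diff[OF module_hom_total] total_first_path total_exceptional)
  then have "mcoeff (?s \<otimes>\<^sub>m ?s) (u, v) =
      mcoeff (mseries.xseries_act (drop_X0 \<phi>) n (\<lambda>F. - (y_snd * F)) (\<lambda>F. - (y_fst * F)) (coprod_star ?s)) (u, v)"
    by (simp add: low2_def n_def)
  also have "\<dots> = mcoeff ((\<Sum>W | length W < n. mscale (mcoeff (drop_X0 \<phi>) W) (prod_list (map abel_letter W))) *
      coprod_star ?s) (u, v)"
    by (simp add: mseries.xseries_act_def xword_act_abel sum_distrib_right)
  \<comment> \<open>Truncation is harmless in each factor: a Y-word is no longer than its weight,
    and \<open>coprod_star\<close> preserves weight.\<close>
  also have "\<dots> = mcoeff (abel_factor \<phi> * coprod_star (\<pi>\<^sub>Y \<phi>)) (u, v)"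
    unfolding mcoeff_times_pair
  proof (intro sum.cong[OF refl], clarify, intro sum.cong[OF refl], clarify)
    fix u1 u2 v1 v2 assume u: "u = u1 + u2" and v: "v = v1 + v2"
    have len: "length w \<le> weight w" for w :: "nat list"
      by (induction w) simp_all
    have "length u1 + length v1 < n" "weight u2 + weight v2 < n"
      using u v len[of u1] len[of v1] by (auto simp: n_def plus_list_def)
    then show "mcoeff (\<Sum>W | length W < n. mscale (mcoeff (drop_X0 \<phi>) W) (prod_list (map abel_letter W))) (u1, v1) *
      mcoeff (coprod_star ?s) (u2, v2) = mcoeff (abel_factor \<phi>) (u1, v1) * mcoeff (coprod_star (\<pi>\<^sub>Y \<phi>)) (u2, v2)"
      using mcoeff_coprod_star_cong[of n ?s "\<pi>\<^sub>Y \<phi>" u2 v2] mcoeff_\<pi>\<^sub>Y_trunc[of _ n \<phi>]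
      by (simp add: mcoeff_sum mcoeff_abel_factor)
  qed
  finally show "mcoeff (\<pi>\<^sub>Y \<phi> \<otimes>\<^sub>m \<pi>\<^sub>Y \<phi>) (u, v) = mcoeff (abel_factor \<phi> * coprod_star (\<pi>\<^sub>Y \<phi>)) (u, v)"
    by (simp add: mcoeff_\<pi>\<^sub>Y_trunc n_def)
qed

section \<open>A derivation compatible with the harmonic coproduct\<close>

text \<open>The derivation \<partial>, encoded as the coefficient of Y_1 in the first factor of the
  coproduct. The summand Y_1 \<otimes> Y_(n-1) of \<Delta>(Y_n) gives \<partial> Y_n = Y_(n-1), and
  multiplicativity of the coproduct gives the Leibniz rule.\<close>

definition deriv_Y :: "'k :: field_char_0 yseries \<Rightarrow> 'k yseries" where
  "deriv_Y f = fix_fst [0] (coprod_star f)"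

lemma mcoeff_deriv_Y [simp]:
  "mcoeff (deriv_Y f) [] = mcoeff f [0]"
  "mcoeff (deriv_Y f) (n # v) = mcoeff f (0 # n # v) + mcoeff (deriv_Y (quot_left n f)) v + mcoeff f (Suc n # v)"
  by (simp_all add: deriv_Y_def)

lemma deriv_Y_linear [simp]:
  "deriv_Y (f + g) = deriv_Y f + deriv_Y g" "deriv_Y (f - g) = deriv_Y f - deriv_Y g"
  "deriv_Y (mscale c f) = mscale c (deriv_Y f)" "deriv_Y 0 = 0"
  by (rule mseries_eqI; simp add: deriv_Y_def)+

lemma deriv_Y_sum: "deriv_Y (sum f A) = (\<Sum>i\<in>A. deriv_Y (f i))"
  by (induction A rule: infinite_finite_induct) simp_all

lemma fix_fst_Nil_coprod_star [simp]: "fix_fst [] (coprod_star f) = f"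
  by (rule mseries_eqI) simp

lemma fix_fst_Nil_times:
  "fix_fst [] (F * G) = fix_fst [] F * fix_fst [] (G :: 'k :: field_char_0 yyseries)"
  unfolding fix_fst_times by (simp only: sum_splits_Nil)

lemma fix_fst_single_times:
  "fix_fst [a] (F * G) = fix_fst [] F * fix_fst [a] G + fix_fst [a] F * fix_fst [] (G :: 'k :: field_char_0 yyseries)"
  unfolding fix_fst_times by (simp only: sum_splits_Nil sum_splits_Cons)

lemma deriv_Y_times: "deriv_Y (f * g) = deriv_Y f * g + f * deriv_Y g"
  by (simp add: deriv_Y_def coprod_star_times fix_fst_single_times)

definition deriv_fst :: "'k :: field_char_0 yyseries \<Rightarrow> 'k yyseries" where
  "deriv_fst F = Mseries (\<lambda>(u, v). mcoeff (deriv_Y (fix_snd v F)) u)"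

lemma fix_snd_deriv_fst: "fix_snd v (deriv_fst F) = deriv_Y (fix_snd v F)"
  by (rule mseries_eqI) (simp add: deriv_fst_def)

lemma mcoeff_deriv_fst [simp]: "mcoeff (deriv_fst F) (u, v) = mcoeff (deriv_Y (fix_snd v F)) u"
  by (simp add: deriv_fst_def)

lemma fix_snd_linear:
  "fix_snd v (F + G) = fix_snd v F + fix_snd v G" "fix_snd v (F - G) = fix_snd v F - fix_snd v G"
  "fix_snd v (mscale c F) = mscale c (fix_snd v F)"
  by (rule mseries_eqI; simp)+

lemma yyseries_fix_sndI: "(\<And>v. fix_snd v F = fix_snd v G) \<Longrightarrow> F = G"
  by (rule yyseries_eqI) (metis mcoeff_fix(2))

lemma deriv_fst_diff: "deriv_fst (F - G) = deriv_fst F - deriv_fst G"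
  by (rule yyseries_fix_sndI) (simp add: fix_snd_deriv_fst fix_snd_linear)

lemma deriv_fst_times: "deriv_fst (F * G) = deriv_fst F * G + F * deriv_fst G"
  by (rule yyseries_fix_sndI)
    (simp add: fix_snd_deriv_fst fix_snd_linear fix_snd_times deriv_Y_sum deriv_Y_times
      case_prod_unfold sum.distrib)

text \<open>This is coassociativity, read at the coefficient of Y_1 in the first of three factors;
  the proof goes directly through the stuffle recursion.\<close>

lemma deriv_fst_coprod_star: "deriv_fst (coprod_star f) = coprod_star (deriv_Y f)"
proof (rule yyseries_eqI)
  show "mcoeff (deriv_fst (coprod_star f)) (u, v) = mcoeff (coprod_star (deriv_Y f)) (u, v)" for u v
  proof (induction "length u + length v" arbitrary: u v f rule: less_induct)
    case less
    show ?case
    proof (cases "u = [] \<or> v = []")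
      case True
      have "fix_snd [] (coprod_star f) = f"
        by (rule mseries_eqI) simp
      moreover have "mcoeff (deriv_fst (coprod_star f)) ([], v) = mcoeff (deriv_Y f) v"
        by (simp add: deriv_Y_def)
      ultimately show ?thesis using True by auto
    next
      case False
      then obtain m u' n v' where uv [simp]: "u = m # u'" "v = n # v'"
        by (metis list.exhaust)
      let ?\<Delta> = coprod_star
      have quot_deriv: "quot_left k (deriv_Y g) = deriv_Y (quot_left k g) + quot_left k (quot_left 0 g) +
          quot_left (Suc k) g" for k and g :: "'a yseries"
        by (rule mseries_eqI) simp
      have "quot_left m (fix_snd v (?\<Delta> f)) = fix_snd v (?\<Delta> (quot_left m f)) +
          quot_left m (fix_snd v' (?\<Delta> (quot_left n f))) + fix_snd v' (?\<Delta> (quot_left (Suc (m + n)) f))"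
        by (rule mseries_eqI) simp
      moreover have "mcoeff (deriv_Y (fix_snd v (?\<Delta> (quot_left m f)))) u' = mcoeff (?\<Delta> (deriv_Y (quot_left m f))) (u', v)"
        "mcoeff (deriv_Y (fix_snd v' (?\<Delta> (quot_left n f)))) u = mcoeff (?\<Delta> (deriv_Y (quot_left n f))) (u, v')"
        "mcoeff (deriv_Y (fix_snd v' (?\<Delta> (quot_left (Suc (m + n)) f)))) u' =
           mcoeff (?\<Delta> (deriv_Y (quot_left (Suc (m + n)) f))) (u', v')"
        using less.hyps[of u' v "quot_left m f"] less.hyps[of u v' "quot_left n f"]
          less.hyps[of u' v' "quot_left (Suc (m + n)) f"] by simp_all
      ultimately show ?thesis
        by (simp add: quot_deriv algebra_simps)
    qed
  qed
qed

section \<open>Power series in the first letter\<close>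

definition y_fps :: "'k :: field_char_0 fps \<Rightarrow> 'k yseries" where
  "y_fps a = Mseries (\<lambda>w. if set w \<subseteq> {0} then fps_nth a (length w) else 0)"

lemma mcoeff_y_fps [simp]: "mcoeff (y_fps a) w = (if set w \<subseteq> {0} then fps_nth a (length w) else 0)"
  by (simp add: y_fps_def)

lemma sum_splits_list:
  "(\<Sum>(u, v)\<in>{(u, v). u + v = w}. f u v) = (\<Sum>i\<le>length w. f (take i w) (drop i w))"
  by (rule sum.reindex_bij_witness[where i = "\<lambda>i. (take i w, drop i w)" and j = "\<lambda>(u, v). length u"])
    (auto simp: plus_list_def)

lemma y_fps_times: "y_fps (a * b) = y_fps a * y_fps b"
proof (rule mseries_eqI)
  fix w
  show "mcoeff (y_fps (a * b)) w = mcoeff (y_fps a * y_fps b) w"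
  proof (cases "set w \<subseteq> {0}")
    case True
    then have "set (take i w) \<subseteq> {0}" "set (drop i w) \<subseteq> {0}" for i
      by (meson order_trans set_take_subset set_drop_subset)+
    with True show ?thesis
      by (simp add: times_mseries.rep_eq sum_splits_list[where f = "\<lambda>u v. mcoeff (y_fps a) u * mcoeff (y_fps b) v"]
          fps_mult_nth atLeast0AtMost min_absorb2 del: mcoeff_y_fps)
        (simp add: fps_mult_nth atLeast0AtMost min_absorb2)
  next
    case False
    then have "\<not> (set u \<subseteq> {0} \<and> set v \<subseteq> {0})" if "u + v = w" for u v
      using that by (auto simp: plus_list_def)
    then have "mcoeff (y_fps a * y_fps b) w = 0"
      unfolding times_mseries.rep_eq by (intro sum.neutral) auto
    with False show ?thesis by simp
  qed
qed

lemma y_fps_one [simp]: "y_fps 1 = 1"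
  by (rule mseries_eqI) auto

lemma y_fps_power: "y_fps (a ^ n) = y_fps a ^ n"
  by (induction n) (simp_all add: y_fps_times)

lemma y_fps_X: "y_fps fps_X = mletter 0"
proof (rule mseries_eqI)
  show "mcoeff (y_fps fps_X) w = mcoeff (mletter 0) w" for w
    by (cases w) auto
qed

text \<open>Since \<partial> Y_1 = 1, the derivation is formal differentiation on series in
  Y_1.\<close>

lemma deriv_y_fps: "deriv_Y (y_fps a) = y_fps (fps_deriv a)"
proof (rule mseries_eqI)
  show "mcoeff (deriv_Y (y_fps a)) w = mcoeff (y_fps (fps_deriv a)) w" for w
  proof (induction w arbitrary: a)
    case (Cons n w)
    have "quot_left n (y_fps a) = (if n = 0 then y_fps (fps_shift 1 a) else 0)"
      by (rule mseries_eqI) simp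
    with Cons show ?case by (simp add: algebra_simps)
  qed simp
qed

text \<open>Presents the correction as exp(g(Y_1)). Differentiating g removes the factors 1/n and
  leaves the coefficients found in the linear part of \<open>abel_factor\<close>.\<close>

lemma series_corr_eq:
  fixes \<phi> :: "(xletter list, 'k :: field_char_0) mseries"
  obtains g where "fps_nth g 0 = 0" "\<And>n. fps_nth (fps_deriv g) n = (-1) ^ Suc n * mcoeff \<phi> (replicate n X0 @ [X1])"
    "series_corr \<phi> = y_fps (fps_compose (fps_exp 1) g)"
proof -
  let ?c = "\<lambda>n. (-1) ^ Suc n / of_nat (Suc n) * mcoeff \<phi> (replicate n X0 @ [X1])"
  define g where "g = Abs_fps (\<lambda>n. case n of 0 \<Rightarrow> 0 | Suc n \<Rightarrow> ?c n)"
  have g0: "fps_nth g 0 = 0"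
    by (simp add: g_def)
  have g': "fps_nth (fps_deriv g) n = (-1) ^ Suc n * mcoeff \<phi> (replicate n X0 @ [X1])" for n
    by (simp add: g_def del: of_nat_Suc)
  have "msum (\<lambda>n. mscale (?c n) (Yser 1 ^ Suc n)) = y_fps g"
  proof (rule mseries_eqI)
    fix w
    \<comment> \<open>For the empty word \<open>length w - 1\<close> is 0, which is harmless because
      g has constant term 0.\<close>
    have coeff: "mcoeff (mscale (?c n) (Yser 1 ^ Suc n)) w = (if n = length w - 1 then mcoeff (y_fps g) w else 0)" for n
    proof -
      have "mcoeff (mscale (?c n) (Yser 1 ^ Suc n)) w = ?c n * mcoeff (y_fps (fps_X ^ Suc n)) w"
        by (simp add: y_fps_X y_fps_power del: power_Suc mcoeff_y_fps)
      also have "\<dots> = (if n = length w - 1 then mcoeff (y_fps g) w else 0)"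
        by (auto simp: g_def fps_X_power_nth split: nat.split simp del: power_Suc)
      finally show ?thesis .
    qed
    show "mcoeff (msum (\<lambda>n. mscale (?c n) (Yser 1 ^ Suc n))) w = mcoeff (y_fps g) w"
      unfolding msum_def mcoeff_Mseries coeff by simp
  qed
  moreover have "mexp (y_fps g) = y_fps (fps_compose (fps_exp 1) g)"
  proof (rule mseries_eqI)
    fix w
    have "mcoeff (mexp (y_fps g)) w = Sum_any (\<lambda>j. 1 / fact j * mcoeff (y_fps (g ^ j)) w)"
      by (simp add: mexp_def msum_def y_fps_power)
    also have "\<dots> = (\<Sum>j = 0..length w. 1 / fact j * mcoeff (y_fps (g ^ j)) w)"
    proof (rule Sum_any.expand_superset)
      have "j \<le> length w" if "mcoeff (y_fps (g ^ j)) w \<noteq> 0" for j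
        using that startsby_zero_power_prefix[OF g0, of j] by (auto simp: not_less[symmetric] split: if_splits)
      then show "{j. 1 / fact j * mcoeff (y_fps (g ^ j)) w \<noteq> 0} \<subseteq> {0..length w}"
        by auto
    qed simp
    also have "\<dots> = mcoeff (y_fps (fps_compose (fps_exp 1) g)) w"
      by (simp add: fps_compose_nth)
    finally show "mcoeff (mexp (y_fps g)) w = mcoeff (y_fps (fps_compose (fps_exp 1) g)) w" .
  qed
  ultimately show ?thesis
    using that[OF g0 g'] by (simp add: series_corr_def)
qed

section \<open>Series in the first letters of both factors\<close>

definition yy_supported :: "'k :: field_char_0 yyseries \<Rightarrow> bool" where
  "yy_supported F \<longleftrightarrow> (\<forall>u v. mcoeff F (u, v) \<noteq> 0 \<longrightarrow> set u \<subseteq> {0} \<and> set v \<subseteq> {0})"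

lemma yy_supported_diff: "yy_supported F \<Longrightarrow> yy_supported G \<Longrightarrow> yy_supported (F - G)"
  unfolding yy_supported_def mcoeff_group_simps by (metis diff_self)

lemma yy_supported_times:
  assumes "yy_supported F" "yy_supported G"
  shows "yy_supported (F * G)"
  unfolding yy_supported_def
proof (intro allI impI)
  fix u v assume "mcoeff (F * G) (u, v) \<noteq> 0"
  then obtain u1 u2 v1 v2 where "u = u1 + u2" "v = v1 + v2" "mcoeff F (u1, v1) * mcoeff G (u2, v2) \<noteq> 0"
    unfolding mcoeff_times_pair by (auto elim!: sum.not_neutral_contains_not_neutral)
  moreover from this have "mcoeff F (u1, v1) \<noteq> 0" "mcoeff G (u2, v2) \<noteq> 0"
    by auto
  with assms have "set u1 \<subseteq> {0} \<and> set v1 \<subseteq> {0}" "set u2 \<subseteq> {0} \<and> set v2 \<subseteq> {0}"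
    unfolding yy_supported_def by blast+
  ultimately show "set u \<subseteq> {0} \<and> set v \<subseteq> {0}"
    by (auto simp: plus_list_def)
qed

text \<open>Y_1 is primitive for \<open>coprod_star\<close>, so no other letter arises from a series
  in Y_1.\<close>

lemma yy_supported_coprod_star: "yy_supported (coprod_star (y_fps a))"
proof -
  have "set u \<subseteq> {0} \<and> set v \<subseteq> {0}" if "mcoeff (coprod_star (y_fps a)) (u, v) \<noteq> 0" for u v
    using that
  proof (induction "length u + length v" arbitrary: u v a rule: less_induct)
    case less
    show ?case
    proof (cases "u = [] \<or> v = []")
      case True
      then show ?thesis using less.prems by (auto split: if_splits)
    next
      case False
      then obtain m u' n v' where uv [simp]: "u = m # u'" "v = n # v'"
        by (metis list.exhaust)
      have quot: "quot_left k (y_fps a) = (if k = 0 then y_fps (fps_shift 1 a) else 0)" for k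
        by (rule mseries_eqI) simp
      have "m = 0 \<and> mcoeff (coprod_star (y_fps (fps_shift 1 a))) (u', v) \<noteq> 0 \<or>
          n = 0 \<and> mcoeff (coprod_star (y_fps (fps_shift 1 a))) (u, v') \<noteq> 0"
        using less.prems by (auto simp: quot split: if_splits)
      then show ?thesis
        using less.hyps[of u' v "fps_shift 1 a"] less.hyps[of u v' "fps_shift 1 a"] by auto
    qed
  qed
  then show ?thesis by (simp add: yy_supported_def)
qed

lemma yy_supported_tensor: "yy_supported (y_fps a \<otimes>\<^sub>m y_fps b)"
  by (auto simp: yy_supported_def split: if_splits)

lemma yy_supported_abel_factor: "yy_supported (abel_factor \<phi>)"
proof -
  have "set u \<subseteq> {0} \<and> set v \<subseteq> {0}" if nz: "mcoeff (abel_factor \<phi>) (u, v) \<noteq> 0" for u v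
  proof -
    from nz obtain W where "mcoeff (prod_list (map abel_letter W)) (u, v) \<noteq> (0 :: 'a)"
      unfolding mcoeff_abel_factor[of u v, OF lessI]
      by (auto elim!: sum.not_neutral_contains_not_neutral)
    then show ?thesis
      by (auto simp: mcoeff_abel_word split: if_splits)
  qed
  then show ?thesis by (simp add: yy_supported_def)
qed

text \<open>Induction on the degree in Y_1 \<otimes> 1. On series with this support \<partial>
  \<otimes> 1 differentiates in that variable, so the equation expresses \<open>length u\<close>
  times the coefficient at \<open>u\<close> through coefficients of smaller degree, and
  characteristic 0 permits division.\<close>

lemma yy_supported_ODE_unique:
  assumes "yy_supported H" "fix_fst [] H = 0" and ode: "deriv_fst H = H * G"
  shows "H = 0"
proof (rule yyseries_eqI)
  show "mcoeff H (u, v) = mcoeff 0 (u, v)" for u v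
  proof (induction "length u" arbitrary: u v rule: less_induct)
    case less
    show ?case
    proof (cases "set u \<subseteq> {0} \<and> set v \<subseteq> {0}")
      case False
      then show ?thesis using \<open>yy_supported H\<close> by (auto simp: yy_supported_def)
    next
      case zeros: True
      show ?thesis
      proof (cases u)
        case Nil
        then show ?thesis
          using \<open>fix_fst [] H = 0\<close> by (metis mcoeff_fix(1) mcoeff_group_simps(1))
      next
        case (Cons b u')
        define a where "a = Abs_fps (\<lambda>i. mcoeff H (replicate i 0, v))"
        have "fix_snd v H = y_fps a"
        proof (rule mseries_eqI)
          fix w :: "nat list"
          show "mcoeff (fix_snd v H) w = mcoeff (y_fps a) w"
          proof (cases "set w \<subseteq> {0}")
            case True
            then have "replicate (length w) 0 = w"
              by (metis replicate_length_same singletonD subsetD)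
            with True show ?thesis by (simp add: a_def)
          next
            case False
            then show ?thesis using \<open>yy_supported H\<close> by (auto simp: yy_supported_def)
          qed
        qed
        then have "mcoeff (deriv_fst H) (u', v) = of_nat (length u) * fps_nth a (length u)"
          using zeros Cons by (simp add: deriv_y_fps)
        also have "fps_nth a (length u) = mcoeff H (u, v)"
        proof -
          have "replicate (length u) 0 = u"
            using zeros by (metis replicate_length_same singletonD subsetD)
          then show ?thesis by (simp add: a_def)
        qed
        also have "mcoeff (deriv_fst H) (u', v) = 0"
          unfolding ode mcoeff_times_pair
        proof (intro sum.neutral ballI, clarify, intro sum.neutral ballI, clarify)
          fix u1 u2 v1 v2 assume "u' = u1 + u2"
          then have "length u1 < length u"
            using Cons by (simp add: plus_list_def)
          from less[OF this] show "mcoeff H (u1, v1) * mcoeff G (u2, v2) = 0"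
            by simp
        qed
        finally show ?thesis
          using Cons by (simp del: of_nat_Suc)
      qed
    qed
  qed
qed

text \<open>As \<open>G\<close> is 1 plus higher terms, a coefficient of \<open>F * G\<close> is
  that of \<open>F\<close> plus contributions of shorter words of \<open>F\<close>.\<close>

lemma yyseries_cancel_right:
  fixes F G :: "'k :: field_char_0 yyseries"
  assumes "F * G = 0" "mcoeff G 0 = 1"
  shows "F = 0"
proof (rule yyseries_eqI)
  show "mcoeff F (u, v) = mcoeff 0 (u, v)" for u v
  proof (induction "length u + length v" arbitrary: u v rule: less_induct)
    case less
    have "0 = mcoeff (F * G) (u, v)"
      using assms by simp
    also have "\<dots> = (\<Sum>(p, q)\<in>{((u, v), 0)}. mcoeff F p * mcoeff G q)"
      unfolding times_mseries.rep_eq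
    proof (rule sum.mono_neutral_right)
      show "\<forall>x\<in>{(p, q). p + q = (u, v)} - {((u, v), 0)}. (case x of (p, q) \<Rightarrow> mcoeff F p * mcoeff G q) = 0"
      proof
        fix x assume x: "x \<in> {(p, q). p + q = (u, v)} - {((u, v), 0)}"
        obtain u1 v1 u2 v2 where [simp]: "x = ((u1, v1), (u2, v2))"
          by (metis surj_pair)
        from x have "length u1 + length v1 < length u + length v"
          by (auto simp: plus_list_def zero_prod_def zero_list_def)
        from less[OF this] show "(case x of (p, q) \<Rightarrow> mcoeff F p * mcoeff G q) = 0"
          by simp
      qed
    qed (auto simp: finite_splits)
    finally show ?case using assms(2) by simp
  qed
qed

text \<open>Without X1 only the empty word survives \<open>drop_X0\<close>. With exactly one X1 the
  survivors are the words X0^n X1, whose coefficients also define the correction.\<close>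

lemma fix_fst_abel_factor:
  assumes "mcoeff \<phi> [] = 1"
  shows "fix_fst [] (abel_factor \<phi>) = 1"
    and "mcoeff (fix_fst [0] (abel_factor \<phi>)) v =
      (if set v \<subseteq> {0} then (-1) ^ Suc (length v) * mcoeff \<phi> (replicate (length v) X0 @ [X1]) else 0)"
proof -
  have no_X1: "W = replicate (length W) X0" if "count_list W X1 = 0" for W
    using that by (metis count_list_0_iff replicate_length_same xletter.exhaust)
  show "fix_fst [] (abel_factor \<phi>) = 1"
  proof (rule mseries_eqI)
    fix v
    have "mcoeff (abel_factor \<phi>) ([], v) = (\<Sum>W :: xletter list | length W < Suc (length v).
        if W = [] then if v = [] then 1 else 0 else 0)"
    unfolding mcoeff_abel_factor[of "[]" v "Suc (length v)", simplified]
    proof (rule sum.cong[OF refl])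
      fix W :: "xletter list"
      have "last W = X0" if "count_list W X1 = 0" "W \<noteq> []"
        using no_X1[OF that(1)] that(2) by (metis last_replicate length_0_conv)
      then show "mcoeff (drop_X0 \<phi>) W * mcoeff (prod_list (map abel_letter W)) ([], v) =
        (if W = [] then if v = [] then 1 else 0 else 0)"
        using assms by (auto simp: mcoeff_abel_word drop_X0_def)
    qed
    also have "\<dots> = mcoeff 1 v"
      by (subst sum.delta[OF finite_xwords]) auto
    finally show "mcoeff (fix_fst [] (abel_factor \<phi>)) v = mcoeff 1 v"
      by simp
  qed
  show "mcoeff (fix_fst [0] (abel_factor \<phi>)) v =
      (if set v \<subseteq> {0} then (-1) ^ Suc (length v) * mcoeff \<phi> (replicate (length v) X0 @ [X1]) else 0)"
  proof -
    let ?W = "replicate (length v) X0 @ [X1]"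
    let ?c = "if set v \<subseteq> {0} then (-1) ^ Suc (length v) * mcoeff \<phi> ?W else 0"
    have "mcoeff (abel_factor \<phi>) ([0], v) = (\<Sum>W | length W < Suc (Suc (length v)). if W = ?W then ?c else 0)"
      unfolding mcoeff_abel_factor[of "[0]" v "Suc (Suc (length v))", simplified]
    proof (rule sum.cong[OF refl])
      fix W :: "xletter list"
      show "mcoeff (drop_X0 \<phi>) W * mcoeff (prod_list (map abel_letter W)) ([0], v) = (if W = ?W then ?c else 0)"
      proof (cases "W = ?W")
        case True
        have "v = replicate (length v) 0 \<longleftrightarrow> set v \<subseteq> {0}"
          by (metis replicate_length_same set_replicate_conv_if singletonD subsetD subsetI empty_iff)
        moreover have "count_list (replicate n X0) X0 = n" "count_list (replicate n X0) X1 = 0" for n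
          by (induction n) simp_all
        ultimately have word: "mcoeff (prod_list (map abel_letter W)) ([0], v) =
            (if set v \<subseteq> {0} then (-1) ^ Suc (length v) else (0 :: 'a))"
          unfolding True mcoeff_abel_word by simp
        have "mcoeff (drop_X0 \<phi>) W = mcoeff \<phi> ?W"
          unfolding True by (simp add: drop_X0_def)
        then show ?thesis
          unfolding word using True by auto
      next
        case False
        have "mcoeff (drop_X0 \<phi>) W = 0 \<or> mcoeff (prod_list (map abel_letter W)) ([0], v) = (0 :: 'a)"
        proof (rule ccontr)
          assume "\<not> ?thesis"
          then have nz: "mcoeff (drop_X0 \<phi>) W \<noteq> 0" "mcoeff (prod_list (map abel_letter W)) ([0], v) \<noteq> (0 :: 'a)"
            by auto
          from nz(2) have cnt: "[0 :: nat] = replicate (count_list W X1) 0" "v = replicate (count_list W X0) 0"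
            by (auto simp: mcoeff_abel_word split: if_splits)
          from cnt(1) have one: "count_list W X1 = 1"
            by (metis length_replicate length_Cons list.size(3) One_nat_def)
          then obtain V a where W: "W = V @ [a]"
            by (cases W rule: rev_cases) auto
          with nz(1) have a: "a = X1"
            by (cases a) (auto simp: drop_X0_def split: if_splits)
          with W one have "V = replicate (length V) X0"
            by (intro no_X1) simp
          moreover have "length V = length v"
            using cnt(2) W a one length_xword[of W] by (metis add_right_cancel length_append_singleton length_replicate Suc_eq_plus1)
          ultimately show False
            using False W a by simp
        qed
        with False show ?thesis by auto
      qed
    qed
    also have "\<dots> = ?c"
      by (subst sum.delta[OF finite_xwords]) simp
    finally show ?thesis by simp
  qed
qed

theorem theorem0p2:
  fixes \<phi> :: "(xletter list, 'k :: field_char_0) mseries"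
  assumes "group_like \<phi>"
    and "pentagon \<phi>"
  shows "generalized_double_shuffle \<phi>"
proof -
  have const: "mcoeff \<phi> [] = 1"
    using assms(1) by (simp add: group_like_def)
  obtain g where g: "fps_nth g 0 = 0"
      "\<And>n. fps_nth (fps_deriv g) n = (-1) ^ Suc n * mcoeff \<phi> (replicate n X0 @ [X1])"
    and corr: "series_corr \<phi> = y_fps (fps_compose (fps_exp 1) g)"
    using series_corr_eq[of \<phi>] by blast
  define e where "e = fps_compose (fps_exp 1) g"
  define h where "h = y_fps (fps_deriv g)"
  define \<Gamma> where "\<Gamma> = abel_factor \<phi>"
  define s where "s = \<pi>\<^sub>Y \<phi>"
  define t where "t = y_fps e * s"
  define K where "K = (y_fps e \<otimes>\<^sub>m y_fps e) * \<Gamma>"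
  define \<kappa> where "\<kappa> = mcoeff s [0]"
  have tensor_s: "s \<otimes>\<^sub>m s = \<Gamma> * coprod_star s"
    unfolding s_def \<Gamma>_def by (rule pentagon_imp_abel_factor[OF const assms(2)])
  have \<Gamma>: "fix_fst [] \<Gamma> = 1" "fix_fst [0] \<Gamma> = h"
    unfolding \<Gamma>_def h_def
    by (auto intro!: mseries_eqI simp: fix_fst_abel_factor[OF const] g(2) simp del: mcoeff_fix fps_deriv_nth)
  have e': "fps_deriv e = e * fps_deriv g"
    unfolding e_def by (simp add: fps_compose_deriv[OF g(1)])
  have e0: "fps_nth e 0 = 1"
    by (simp add: e_def)
  have s0: "mcoeff s [] = 1"
    by (simp add: s_def \<pi>\<^sub>Y_def const)
  \<comment> \<open>The coefficient of Y_1 in the first factor of \<open>tensor_s\<close> reads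
    \<kappa> s = h s + \<partial> s.\<close>
  have deriv_s: "deriv_Y s = mscale \<kappa> s - h * s"
  proof -
    have "fix_fst [0] (s \<otimes>\<^sub>m s) = mscale \<kappa> s"
      by (rule mseries_eqI) (simp add: \<kappa>_def)
    then show ?thesis
      by (simp add: tensor_s fix_fst_single_times \<Gamma> algebra_simps flip: deriv_Y_def)
  qed
  \<comment> \<open>The factor exp(g) is an integrating factor: its derivative cancels the term
    \<open>h * s\<close>.\<close>
  have deriv_t: "deriv_Y t = mscale \<kappa> t"
    unfolding t_def
    by (simp add: deriv_Y_times deriv_y_fps e' y_fps_times deriv_s h_def algebra_simps)
  have tensor_t: "t \<otimes>\<^sub>m t = K * coprod_star s"
    by (simp add: t_def K_def tensor_times[symmetric] tensor_s mult.assoc)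
  have "deriv_fst (t \<otimes>\<^sub>m t) = mscale \<kappa> (t \<otimes>\<^sub>m t)"
  proof (rule yyseries_fix_sndI)
    fix v
    have "fix_snd v (t \<otimes>\<^sub>m t) = mscale (mcoeff t v) t"
      by (rule mseries_eqI) (simp add: mult.commute)
    then show "fix_snd v (deriv_fst (t \<otimes>\<^sub>m t)) = fix_snd v (mscale \<kappa> (t \<otimes>\<^sub>m t))"
      by (simp add: fix_snd_deriv_fst fix_snd_linear deriv_t mult.commute)
  qed
  \<comment> \<open>Differentiating \<open>tensor_t\<close> gives \<kappa> on both sides, and these
    terms cancel; the factor \<open>coprod_star s\<close> has constant term 1 and can be
    removed.\<close>
  then have "(deriv_fst K - K * coprod_star h) * coprod_star s = 0"
    by (simp add: tensor_t deriv_fst_times deriv_fst_coprod_star deriv_s coprod_star_times algebra_simps)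
  then have K': "deriv_fst K = K * coprod_star h"
    using yyseries_cancel_right[of "deriv_fst K - K * coprod_star h" "coprod_star s"] s0 by simp
  \<comment> \<open>Both series solve the same linear equation with factor
    \<open>coprod_star h\<close>, and their parts free of Y_1 \<otimes> 1 are both
    \<open>y_fps e\<close>.\<close>
  have "K - coprod_star (y_fps e) = 0"
  proof (rule yy_supported_ODE_unique)
    show "yy_supported (K - coprod_star (y_fps e))"
      unfolding K_def \<Gamma>_def
      by (intro yy_supported_diff yy_supported_times yy_supported_tensor yy_supported_abel_factor
          yy_supported_coprod_star)
    have "fix_fst [] (y_fps e \<otimes>\<^sub>m y_fps e) = y_fps e"
      by (rule mseries_eqI) (simp add: e0)
    then have "fix_fst [] K = y_fps e"
      by (simp add: K_def fix_fst_Nil_times \<Gamma>)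
    moreover have "fix_fst [] (F - G) = fix_fst [] F - fix_fst [] G" for F G :: "'k yyseries"
      by (rule mseries_eqI) simp
    ultimately show "fix_fst [] (K - coprod_star (y_fps e)) = 0"
      by simp
    have "deriv_fst (coprod_star (y_fps e)) = coprod_star (y_fps e) * coprod_star h"
      by (simp add: deriv_fst_coprod_star deriv_y_fps e' y_fps_times coprod_star_times h_def)
    then show "deriv_fst (K - coprod_star (y_fps e)) = (K - coprod_star (y_fps e)) * coprod_star h"
      by (simp add: deriv_fst_diff K' algebra_simps)
  qed
  then have "coprod_star t = K * coprod_star s"
    by (simp add: t_def coprod_star_times)
  then have "coprod_star t = t \<otimes>\<^sub>m t"
    by (simp only: tensor_t)
  moreover have "series_regularization \<phi> = t"
    by (simp add: series_regularization_def corr t_def e_def s_def)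
  ultimately show ?thesis
    by (simp add: generalized_double_shuffle_def)
qed

end
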